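(* Let $b\ge2$ and $a\ge1$ be integers. The irrationality exponent of $\xi_{\mathbf{s}_{\theta,\rho}}(1/b,1/a)$ (resp. of $\xi_{\mathbf{s}'_{\theta,\rho}}(1/b,1/a)$) is equal to $\max\{\nu(1),\nu(2),\nu(3),\nu(4)\}$.
   Context: Let $\theta\in(0,1)$ be irrational with $\theta=[0;a_1,a_2,\ldots]$ and convergents $p_k/q_k$ ($p_{-1}=1,q_{-1}=0,p_0=0,q_0=1$, $p_{k+1}=a_{k+1}p_k+p_{k-1}$, $q_{k+1}=a_{k+1}q_k+q_{k-1}$). Let $\rho\in[0,1)$. For $n\ge1$ let $s_n=\lfloor n\theta+\rho\rfloor-\lfloor (n-1)\theta+\rho\rfloor$, $s'_n=\lceil n\theta+\rho\rceil-\lceil (n-1)\theta+\rho\rceil$, $\mathbf{s}_{\theta,\rho}=s_1s_2\ldots$, $\mathbf{s}'_{\theta,\rho}=s'_1s'_2\ldots$, and for an infinite word $\mathbf{x}$ over $\{0,1\}$, $\xi_{\mathbf{x}}(\beta,\alpha)=\sum_{n\ge1}x_n\beta^n\alpha^{\sum_{h=1}^n x_h}$. $(b_k)_{k\ge1}$ is the sequence of digits of $\rho-\theta$ in the Ostrowski numeration system with base $\theta$: $\rho-\theta=\sum_{k\ge0} b_{k+1}(q_k\theta-p_k)$, with $0\le b_1\le a_1-1$, $0\le b_k\le a_k$ ($k\ge2$), $b_{k+1}=a_{k+1}\Rightarrow b_k=0$ ($k\ge1$), normalized as in the authors' earlier work on Sturmian words. Set $t_k=\sum_{j=1}^k b_jq_{j-1}$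 and $r_k=q_k-t_k$ ($k\ge0$). Define $\nu_k(1)=2+\frac{t_k}{r_{k+1}}$, $\nu_k(2)=2+\frac{r_k}{r_{k+1}+t_k}$, $\nu_k(3)=1+\frac{q_{k+1}}{r_{k+1}+q_k}$, $\nu_k(4)=1+\frac{r_{k+2}}{q_{k+1}}$, and $\nu(1)=\limsup_{k\to\infty}\{\nu_k(1): a_{k+1}-b_{k+1}\ge1 \text{ and } a_{k+2}-b_{k+2}\ge1\}$, $\nu(2)=\limsup_{k\to\infty}\{\nu_k(2): a_{k+2}-b_{k+2}\ge1\}$, $\nu(3)=\limsup_k\nu_k(3)$, $\nu(4)=\limsup_k\nu_k(4)$. The irrationality exponent $\mu(\xi)$ of an irrational real $\xi$ is the supremum of the real numbers $\mu$ such that $|\xi-p/q|<q^{-\mu}$ has infinitely many rational solutions $p/q$. *)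

theory Defs
  imports Complex_Main "HOL-Library.Extended_Real"
begin

text \<open>
  Partial quotients \<open>a\<close> and Ostrowski digits \<open>b\<close> are sequences indexed from 1; their values at 0 are
  never used.
\<close>

text \<open>
  The value at index 1 is the recurrence with \<open>p\<^bsub>-1\<^esub> = 1\<close>, \<open>p\<^bsub>0\<^esub> = 0\<close> and \<open>q\<^bsub>-1\<^esub> = 0\<close>, \<open>q\<^bsub>0\<^esub> = 1\<close>.
\<close>

fun cf_num :: "(nat \<Rightarrow> nat) \<Rightarrow> nat \<Rightarrow> nat" where
  "cf_num a 0 = 0"
| "cf_num a (Suc 0) = 1"
| "cf_num a (Suc (Suc k)) = a (Suc (Suc k)) * cf_num a (Suc k) + cf_num a k"

fun cf_den :: "(nat \<Rightarrow> nat) \<Rightarrow> nat \<Rightarrow> nat" where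
  "cf_den a 0 = 1"
| "cf_den a (Suc 0) = a 1"
| "cf_den a (Suc (Suc k)) = a (Suc (Suc k)) * cf_den a (Suc k) + cf_den a k"

text \<open>\<open>\<theta> = [0; a\<^bsub>1\<^esub>, a\<^bsub>2\<^esub>, \<dots>]\<close>\<close>

definition cf_expansion :: "real \<Rightarrow> (nat \<Rightarrow> nat) \<Rightarrow> bool" where
  "cf_expansion \<theta> a \<longleftrightarrow>
     (\<forall>k\<ge>1. 1 \<le> a k) \<and> (\<lambda>k. real (cf_num a k) / real (cf_den a k)) \<longlonglongrightarrow> \<theta>"

text \<open>
  For \<open>x\<close> congruent modulo 1 to \<open>-m\<theta>\<close> with \<open>m \<ge> 1\<close> there can be two admissible digit sequences, one
  ending in \<open>b\<^bsub>k\<^esub> = a\<^bsub>k\<^esub>\<close> for all large even \<open>k\<close> and the other for all large odd \<open>k\<close>. The usual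
  normalization excludes one of these two tails; no choice is made here, so the predicate holds of the
  normalized digit sequence under either choice.
\<close>

definition ostrowski_digits :: "real \<Rightarrow> (nat \<Rightarrow> nat) \<Rightarrow> real \<Rightarrow> (nat \<Rightarrow> nat) \<Rightarrow> bool" where
  "ostrowski_digits \<theta> a x b \<longleftrightarrow>
     b 1 + 1 \<le> a 1 \<and>
     (\<forall>k\<ge>2. b k \<le> a k) \<and>
     (\<forall>k\<ge>1. b (k + 1) = a (k + 1) \<longrightarrow> b k = 0) \<and>
     (\<lambda>k. real (b (k + 1)) * (real (cf_den a k) * \<theta> - real (cf_num a k))) sums x"

definition ost_t :: "(nat \<Rightarrow> nat) \<Rightarrow> (nat \<Rightarrow> nat) \<Rightarrow> nat \<Rightarrow> nat" where
  "ost_t a b k = (\<Sum>j=1..k. b j * cf_den a (j - 1))"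

definition ost_r :: "(nat \<Rightarrow> nat) \<Rightarrow> (nat \<Rightarrow> nat) \<Rightarrow> nat \<Rightarrow> int" where
  "ost_r a b k = int (cf_den a k) - int (ost_t a b k)"

text \<open>
  Words are functions whose letters are the values at \<open>n \<ge> 1\<close>. The truncation by \<^const>\<open>nat\<close> is
  harmless: the differences are 0 or 1 when \<open>0 < \<theta> < 1\<close>.
\<close>

definition sturmian_floor :: "real \<Rightarrow> real \<Rightarrow> nat \<Rightarrow> nat" where
  "sturmian_floor \<theta> \<rho> n = nat (\<lfloor>real n * \<theta> + \<rho>\<rfloor> - \<lfloor>(real n - 1) * \<theta> + \<rho>\<rfloor>)"

definition sturmian_ceiling :: "real \<Rightarrow> real \<Rightarrow> nat \<Rightarrow> nat" where
  "sturmian_ceiling \<theta> \<rho> n = nat (\<lceil>real n * \<theta> + \<rho>\<rceil> - \<lceil>(real n - 1) * \<theta> + \<rho>\<rceil>)"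

definition xi :: "(nat \<Rightarrow> nat) \<Rightarrow> real \<Rightarrow> real \<Rightarrow> real" where
  "xi x \<beta> \<alpha> = (\<Sum>n. real (x (Suc n)) * \<beta> ^ Suc n * \<alpha> ^ (\<Sum>h=1..Suc n. x h))"

text \<open>
  An upper limit over a set \<open>S\<close> of indices is the \<^const>\<open>Limsup\<close> along \<^term>\<open>sequentially\<close>
  restricted to \<open>S\<close>; if \<open>S\<close> is finite it is \<open>-\<infinity>\<close>.
\<close>

definition limsup_on :: "nat set \<Rightarrow> (nat \<Rightarrow> real) \<Rightarrow> ereal" where
  "limsup_on S f = Limsup (inf sequentially (principal S)) (\<lambda>k. ereal (f k))"

definition nu1 :: "(nat \<Rightarrow> nat) \<Rightarrow> (nat \<Rightarrow> nat) \<Rightarrow> ereal" where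
  "nu1 a b = limsup_on {k. int (a (k + 1)) - int (b (k + 1)) \<ge> 1 \<and> int (a (k + 2)) - int (b (k + 2)) \<ge> 1}
     (\<lambda>k. 2 + real (ost_t a b k) / real_of_int (ost_r a b (k + 1)))"

definition nu2 :: "(nat \<Rightarrow> nat) \<Rightarrow> (nat \<Rightarrow> nat) \<Rightarrow> ereal" where
  "nu2 a b = limsup_on {k. int (a (k + 2)) - int (b (k + 2)) \<ge> 1}
     (\<lambda>k. 2 + real_of_int (ost_r a b k) / (real_of_int (ost_r a b (k + 1)) + real (ost_t a b k)))"

definition nu3 :: "(nat \<Rightarrow> nat) \<Rightarrow> (nat \<Rightarrow> nat) \<Rightarrow> ereal" where
  "nu3 a b = limsup_on UNIV
     (\<lambda>k. 1 + real (cf_den a (k + 1)) / (real_of_int (ost_r a b (k + 1)) + real (cf_den a k)))"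

definition nu4 :: "(nat \<Rightarrow> nat) \<Rightarrow> (nat \<Rightarrow> nat) \<Rightarrow> ereal" where
  "nu4 a b = limsup_on UNIV
     (\<lambda>k. 1 + real_of_int (ost_r a b (k + 2)) / real (cf_den a (k + 1)))"

text \<open>Solutions are counted as rational numbers; the exponent may be \<open>\<infinity>\<close>.\<close>

definition irrationality_exponent :: "real \<Rightarrow> ereal" where
  "irrationality_exponent x =
     Sup (ereal ` {\<mu>. infinite {y. \<exists>p q :: int. 0 < q \<and> y = real_of_int p / real_of_int q \<and>
                                     \<bar>x - y\<bar> < real_of_int q powr (- \<mu>)}})"

end

theory Submission
  imports Defs "HOL-Library.Sublist"
begin

text \<open>
  Let \<open>M\<^sub>k\<close> be the standard words of slope \<open>\<theta>\<close>, and split \<open>M\<^sub>k = X\<^sub>k W\<^sub>k\<close> with \<open>X\<^sub>k\<close> of length \<open>t\<^sub>k\<close> and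
  \<open>W\<^sub>k\<close> of length \<open>r\<^sub>k\<close>. Up to at most two letters, both Sturmian words begin with \<open>W\<^sub>k M\<^sub>k\<^sub>-\<^sub>1\<close> whenever
  \<open>b\<^sub>k\<^sub>+\<^sub>1 < a\<^sub>k\<^sub>+\<^sub>1\<close>. Since \<open>M\<^sub>k M\<^sub>k\<^sub>-\<^sub>1\<close> and \<open>M\<^sub>k\<^sub>-\<^sub>1 M\<^sub>k\<close> differ in their last two letters only, the tail behind
  \<open>W\<^sub>k\<close> agrees with suitable periodic words up to an exactly known position. This gives rational
  approximations \<open>P/Q\<close> with \<open>Q\<close> of order \<open>x\<^sup>d\<close> and \<open>\<bar>Q \<xi> - P\<bar>\<close> of order \<open>x\<^sup>-\<^sup>n\<close>, where \<open>x = b a\<^sup>\<theta>\<close> and \<open>(d, n)\<close> is one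
  of \<open>(q\<^sub>k\<^sub>+\<^sub>1, r\<^sub>k\<^sub>+\<^sub>2)\<close>, \<open>(r\<^sub>k\<^sub>+\<^sub>1, r\<^sub>k\<^sub>+\<^sub>1 + t\<^sub>k)\<close>, \<open>(r\<^sub>k\<^sub>+\<^sub>1 + t\<^sub>k, r\<^sub>k\<^sub>+\<^sub>1 + q\<^sub>k)\<close> and \<open>(r\<^sub>k\<^sub>+\<^sub>1 + q\<^sub>k, q\<^sub>k\<^sub>+\<^sub>1)\<close>; then
  \<open>1 + n/d\<close> is one of the \<open>\<nu>\<^sub>k(i)\<close>. The intervals from \<open>d\<close> to \<open>n\<close> of the approximations with exactly known
  error cover all large numbers, which excludes better approximations.
\<close>

section \<open>Irrationality exponents from explicit approximations\<close>

text \<open>The quality of a periodic approximation is decided at the first place where the period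
  fails. There \<open>10\<close> faces \<open>01\<close>, and the two numerators differ by exactly
  \<open>B - 1\<close>. For \<open>B = 2\<close> this is only 1, which the two tails could cancel;
  so an error counts as exactly known only when both sides continue with a common word that contains
  a 0. One-sided error bounds suffice to bound the exponent from below. The bound from above needs
  two-sided ones, because a given fraction may coincide with one of the approximations. Full digits
  \<open>b (Suc k) = a (Suc k)\<close> disturb the regular pattern: the word \<open>Ww\<close> then
  returns to its value two indices earlier, and its length may even stay bounded. Two of the
  families also lose their lower bound in degenerate cases, where the period survives longer than
  usual; there an interval of another family reaches far enough to close the hole.\<close>

definition approximable :: "real \<Rightarrow> real \<Rightarrow> real \<Rightarrow> real \<Rightarrow> bool" where
  "approximable \<xi> C u v \<longleftrightarrow>
     (\<exists>P Q :: int. 0 < Q \<and> real_of_int Q \<le> C * u \<and> \<bar>real_of_int Q * \<xi> - real_of_int P\<bar> \<le> C / v)"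

definition sharply_approximable :: "real \<Rightarrow> real \<Rightarrow> real \<Rightarrow> real \<Rightarrow> bool" where
  "sharply_approximable \<xi> C u v \<longleftrightarrow>
     (\<exists>P Q :: int. 0 < Q \<and> real_of_int Q \<le> C * u \<and> \<bar>real_of_int Q * \<xi> - real_of_int P\<bar> \<le> C / v
        \<and> 1 / (C * v) \<le> \<bar>real_of_int Q * \<xi> - real_of_int P\<bar>)"

lemma sharply_imp_approximable: "sharply_approximable \<xi> C u v \<Longrightarrow> approximable \<xi> C u v"
  unfolding approximable_def sharply_approximable_def by blast

text \<open>With denominator \<open>h * Q\<close> and numerator \<open>g * P + c * Q\<close> the
  error becomes \<open>g * (Q * \<xi> - P)\<close>. The factor \<open>g + h\<close> pays both for
  the larger denominator and for the larger error.\<close>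

lemma approximable_affine:
  fixes g h c :: int and \<xi> \<xi>' C u v :: real
  assumes "approximable \<xi> C u v" "0 < g" "0 < h" "0 < C" "0 < u" "0 < v"
    and \<xi>': "\<xi>' = (g * \<xi> + c) / h"
  shows "approximable \<xi>' (C * (g + h)) u v"
proof -
  obtain P Q :: int where PQ: "0 < Q" "real_of_int Q \<le> C * u" "\<bar>Q * \<xi> - P\<bar> \<le> C / v"
    using assms(1) unfolding approximable_def by blast
  have h\<xi>: "h * \<xi>' = g * \<xi> + c" using assms by simp
  have "(h * Q) * \<xi>' = Q * (h * \<xi>')" by simp
  then have e: "(h * Q) * \<xi>' - (g * P + c * Q) = g * (Q * \<xi> - P)"
    unfolding h\<xi> by (simp add: algebra_simps)
  have "real_of_int (h * Q) \<le> C * (g + h) * u"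
  proof -
    have "real_of_int (h * Q) \<le> h * (C * u)" using PQ assms by simp
    also have "\<dots> \<le> (g + h) * (C * u)" using assms by (intro mult_right_mono) auto
    finally show ?thesis by (simp add: algebra_simps)
  qed
  moreover have "\<bar>(h * Q) * \<xi>' - (g * P + c * Q)\<bar> \<le> C * (g + h) / v"
  proof -
    have "\<bar>(h * Q) * \<xi>' - (g * P + c * Q)\<bar> = g * \<bar>Q * \<xi> - P\<bar>"
      using e assms by (simp add: abs_mult)
    also have "\<dots> \<le> g * (C / v)" using PQ(3) assms(2) by (intro mult_left_mono) auto
    also have "\<dots> \<le> (g + h) * (C / v)" using assms by (intro mult_right_mono) auto
    finally show ?thesis by (simp add: mult.commute)
  qed
  moreover have "0 < h * Q" using PQ assms by simp
  ultimately show ?thesis unfolding approximable_def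
    by (metis of_int_add of_int_mult)
qed

lemma sharply_approximable_affine:
  fixes g h c :: int and \<xi> \<xi>' C u v :: real
  assumes "sharply_approximable \<xi> C u v" "0 < g" "0 < h" "0 < C" "0 < u" "0 < v"
    and \<xi>': "\<xi>' = (g * \<xi> + c) / h"
  shows "sharply_approximable \<xi>' (C * (g + h)) u v"
proof -
  obtain P Q :: int where PQ: "0 < Q" "real_of_int Q \<le> C * u" "\<bar>Q * \<xi> - P\<bar> \<le> C / v"
    "1 / (C * v) \<le> \<bar>Q * \<xi> - P\<bar>"
    using assms(1) unfolding sharply_approximable_def by blast
  have h\<xi>: "h * \<xi>' = g * \<xi> + c" using assms by simp
  have "(h * Q) * \<xi>' = Q * (h * \<xi>')" by simp
  then have e: "(h * Q) * \<xi>' - (g * P + c * Q) = g * (Q * \<xi> - P)"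
    unfolding h\<xi> by (simp add: algebra_simps)
  have abs: "\<bar>(h * Q) * \<xi>' - (g * P + c * Q)\<bar> = g * \<bar>Q * \<xi> - P\<bar>"
    using e assms by (simp add: abs_mult)
  have gh: "1 \<le> real_of_int g" "1 \<le> real_of_int g + real_of_int h" using assms by linarith+
  have "real_of_int (h * Q) \<le> C * (g + h) * u"
  proof -
    have "real_of_int (h * Q) \<le> h * (C * u)" using PQ assms by simp
    also have "\<dots> \<le> (g + h) * (C * u)" using assms by (intro mult_right_mono) auto
    finally show ?thesis by (simp add: algebra_simps)
  qed
  moreover have "\<bar>(h * Q) * \<xi>' - (g * P + c * Q)\<bar> \<le> C * (g + h) / v"
  proof -
    have "g * \<bar>Q * \<xi> - P\<bar> \<le> g * (C / v)" using PQ(3) assms(2) by (intro mult_left_mono) auto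
    also have "\<dots> \<le> (g + h) * (C / v)" using assms by (intro mult_right_mono) auto
    finally show ?thesis unfolding abs by (simp add: mult.commute)
  qed
  moreover have "1 / (C * (g + h) * v) \<le> \<bar>(h * Q) * \<xi>' - (g * P + c * Q)\<bar>"
  proof -
    have "1 / (C * (g + h) * v) = 1 / (C * v) / (g + h)" by simp
    also have "\<dots> \<le> 1 / (C * v) / 1" using gh assms by (intro divide_left_mono) auto
    also have "\<dots> \<le> 1 * \<bar>Q * \<xi> - P\<bar>" using PQ by simp
    also have "\<dots> \<le> g * \<bar>Q * \<xi> - P\<bar>" using gh by (intro mult_right_mono) auto
    finally show ?thesis unfolding abs .
  qed
  moreover have "0 < h * Q" using PQ assms by simp
  ultimately show ?thesis unfolding sharply_approximable_def
    by (metis of_int_add of_int_mult)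
qed

lemma approximable_mono:
  assumes "approximable \<xi> D u v" "1 \<le> D" "1 \<le> F" "0 < v" "0 < v'" "u \<le> F * u'" "v' \<le> F * v"
  shows "approximable \<xi> (D * F) u' v'"
proof -
  obtain P Q :: int where PQ: "0 < Q" "real_of_int Q \<le> D * u" "\<bar>Q * \<xi> - P\<bar> \<le> D / v"
    using assms(1) unfolding approximable_def by blast
  have "D * u \<le> D * (F * u')" using assms by (intro mult_left_mono) auto
  then have "real_of_int Q \<le> D * F * u'" using PQ by simp
  moreover have "D / v \<le> D * F / v'" using assms by (simp add: field_simps)
  ultimately show ?thesis unfolding approximable_def using PQ by (metis order_trans)
qed

lemma sharply_approximable_mono:
  assumes "sharply_approximable \<xi> D u v" "1 \<le> D" "1 \<le> F" "0 < v" "0 < v'"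
    "u \<le> F * u'" "v' \<le> F * v" "v \<le> F * v'"
  shows "sharply_approximable \<xi> (D * F) u' v'"
proof -
  obtain P Q :: int where PQ: "0 < Q" "real_of_int Q \<le> D * u" "\<bar>Q * \<xi> - P\<bar> \<le> D / v"
    "1 / (D * v) \<le> \<bar>Q * \<xi> - P\<bar>"
    using assms(1) unfolding sharply_approximable_def by blast
  have "D * u \<le> D * (F * u')" using assms by (intro mult_left_mono) auto
  then have "real_of_int Q \<le> D * F * u'" using PQ by simp
  moreover have "D / v \<le> D * F / v'" using assms by (simp add: field_simps)
  moreover have "1 / (D * F * v') \<le> 1 / (D * v)" using assms by (simp add: field_simps)
  ultimately show ?thesis unfolding sharply_approximable_def using PQ by (metis order_trans)
qed

lemma finite_rationals_bounded_denominator: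
  "finite {y :: real. \<exists>p q :: int. 0 < q \<and> real_of_int q \<le> K \<and> y = real_of_int p / real_of_int q \<and> \<bar>\<xi> - y\<bar> < 1}"
    (is "finite ?S")
proof -
  define R where "R = \<lceil>K * (\<bar>\<xi>\<bar> + 1)\<rceil>"
  have "?S \<subseteq> (\<lambda>(p, q). real_of_int p / real_of_int q) ` ({-R..R} \<times> {1..\<lceil>K\<rceil>})"
  proof
    fix y assume "y \<in> ?S"
    then obtain p q :: int where pq: "0 < q" "real_of_int q \<le> K" "y = p / q" "\<bar>\<xi> - y\<bar> < 1" by blast
    have "\<bar>real_of_int p\<bar> = q * \<bar>y\<bar>" using pq by (simp add: abs_mult)
    also have "\<dots> \<le> K * (\<bar>\<xi>\<bar> + 1)" using pq by (intro mult_mono) auto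
    finally have "\<bar>real_of_int p\<bar> \<le> of_int R" unfolding R_def by (simp add: le_of_int_ceiling order_trans)
    then have "p \<in> {-R..R}" by auto
    moreover have "q \<in> {1..\<lceil>K\<rceil>}" using pq by (auto simp: le_ceiling_iff)
    ultimately show "y \<in> (\<lambda>(p, q). real_of_int p / real_of_int q) ` ({-R..R} \<times> {1..\<lceil>K\<rceil>})"
      using pq(3) by force
  qed
  then show ?thesis by (rule finite_subset) auto
qed

text \<open>
  A fraction \<open>p/q\<close> is either different from a sharp approximation at scale about \<open>q\<close>, and then it is
  at distance at least a constant times \<open>q\<^sup>-\<^sup>2\<close>, or equal to it, and then its distance is known.
\<close>

lemma irrationality_exponent_le:
  assumes x: "1 < x" and C: "1 \<le> C" and m: "2 \<le> m"
    and cover: "\<And>N. N0 \<le> N \<Longrightarrow> \<exists>d n :: nat. sharply_approximable \<xi> C (x ^ d) (x ^ n) \<and>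
          real d \<le> N \<and> N \<le> real n \<and> real n \<le> (m - 1) * real d"
  shows "irrationality_exponent \<xi> \<le> ereal m"
  unfolding irrationality_exponent_def
proof (rule Sup_least, clarify)
  fix \<mu>
  let ?S = "{y. \<exists>p q :: int. 0 < q \<and> y = real_of_int p / real_of_int q \<and>
                                     \<bar>\<xi> - y\<bar> < real_of_int q powr (- \<mu>)}"
  assume inf: "infinite ?S"
  show "ereal \<mu> \<le> ereal m"
  proof (rule ccontr)
    assume "\<not> ?thesis"
    then have mu: "m < \<mu>" by simp
    \<comment> \<open>The three thresholds make \<open>cover\<close> applicable, settle the case of
      two different fractions, and settle the case of equal ones.\<close>
    define K where "K = max (x powr N0) (max ((4 * C\<^sup>2) powr (1 / (\<mu> - 2))) ((C\<^sup>2 * (2 * C) powr m) powr (1 / (\<mu> - m))))"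
    have small: "real_of_int q \<le> K" if pq: "0 < q" "\<bar>\<xi> - p / q\<bar> < real_of_int q powr (- \<mu>)" for p q :: int
    proof (rule ccontr)
      assume "\<not> real_of_int q \<le> K"
      then have K: "x powr N0 < q" "(4 * C\<^sup>2) powr (1 / (\<mu> - 2)) < q"
        "(C\<^sup>2 * (2 * C) powr m) powr (1 / (\<mu> - m)) < q" unfolding K_def by auto
      have q1: "1 \<le> real_of_int q" using pq(1) by linarith
      have big: "y < real_of_int q powr e" if "y powr (1 / e) < q" "0 < y" "0 < e" for y e
      proof -
        have "y = (y powr (1 / e)) powr e" using that by (simp add: powr_powr)
        also have "\<dots> < real_of_int q powr e" using that by (intro powr_less_mono2) auto
        finally show ?thesis .
      qed
      have b2: "4 * C\<^sup>2 < real_of_int q powr (\<mu> - 2)" using K C mu m by (intro big) auto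
      have bm: "C\<^sup>2 * (2 * C) powr m < real_of_int q powr (\<mu> - m)" using K C mu m by (intro big) auto
      \<comment> \<open>With \<open>x powr N = 2 * C * q\<close>, the bound \<open>N \<le> n\<close>
        gives \<open>q * (C / x ^ n) \<le> 1 / 2\<close>, so half of the distance 1 between
        different cross products survives, while \<open>d \<le> N\<close> keeps \<open>Q\<close>
        below a constant multiple of \<open>q\<close>.\<close>
      define N where "N = log x (2 * C * q)"
      have xN: "x powr N = 2 * C * q" unfolding N_def using x C q1 by (simp add: powr_log_cancel)
      have "N0 \<le> N"
      proof -
        have "x powr N0 \<le> 2 * C * q"
        proof -
          have "1 * real_of_int q \<le> 2 * C * q" using C q1 by (intro mult_right_mono) auto
          then show ?thesis using K(1) by linarith
        qed
        then have "x powr N0 \<le> x powr N" using xN by simp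
        then show ?thesis using x by simp
      qed
      then obtain d n :: nat where dn: "sharply_approximable \<xi> C (x ^ d) (x ^ n)"
          "real d \<le> N" "N \<le> real n" "real n \<le> (m - 1) * real d" using cover by blast
      have xd: "x ^ d \<le> 2 * C * q"
      proof -
        have "x ^ d = x powr d" using x by (simp add: powr_realpow)
        also have "\<dots> \<le> x powr N" using dn x by simp
        finally show ?thesis using xN by simp
      qed
      have xn: "2 * C * q \<le> x ^ n"
      proof -
        have "x powr N \<le> x powr n" using dn x by simp
        also have "x powr n = x ^ n" using x by (simp add: powr_realpow)
        finally show ?thesis using xN by simp
      qed
      from dn(1) obtain P Q :: int where PQ: "0 < Q" "real_of_int Q \<le> C * x ^ d" "\<bar>Q * \<xi> - P\<bar> \<le> C / x ^ n"
        "1 / (C * x ^ n) \<le> \<bar>Q * \<xi> - P\<bar>" unfolding sharply_approximable_def by blast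
      show False
      proof (cases "P * q = p * Q")
        case True
        then have "real_of_int P * q = p * Q" by (metis of_int_mult)
        then have eq: "\<xi> - p / q = (Q * \<xi> - P) / Q" using pq(1) PQ(1) by (simp add: field_simps)
        have le: "x ^ n * x ^ d \<le> (2 * C) powr m * q powr m"
        proof -
          have "x ^ n * x ^ d = x powr (real n + real d)" using x by (simp add: powr_add powr_realpow)
          also have "\<dots> \<le> x powr (real d * m)" using dn(4) x by (simp add: algebra_simps)
          also have "\<dots> = (x ^ d) powr m" using x by (simp add: powr_powr[symmetric] powr_realpow)
          also have "\<dots> \<le> (2 * C * q) powr m" using xd x m by (intro powr_mono2) auto
          also have "\<dots> = (2 * C) powr m * q powr m" using C q1 by (simp add: powr_mult)
          finally show ?thesis .
        qed
        have "1 / (C\<^sup>2 * (x ^ n * x ^ d)) = (1 / (C * x ^ n)) / (C * x ^ d)" by (simp add: power2_eq_square)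
        also have "\<dots> \<le> \<bar>Q * \<xi> - P\<bar> / Q"
          using PQ C x by (intro frac_le) auto
        also have "\<dots> = \<bar>\<xi> - p / q\<bar>" unfolding eq using PQ(1) by simp
        also have "\<dots> < q powr (- \<mu>)" by (rule pq(2))
        finally have "1 < q powr (- \<mu>) * (C\<^sup>2 * (x ^ n * x ^ d))" using C x by (simp add: field_simps)
        also have "\<dots> \<le> q powr (- \<mu>) * (C\<^sup>2 * ((2 * C) powr m * q powr m))"
          using le by (intro mult_left_mono) auto
        also have "\<dots> = q powr (- \<mu>) * q powr m * (C\<^sup>2 * (2 * C) powr m)" by simp
        also have "\<dots> < q powr (- \<mu>) * q powr m * q powr (\<mu> - m)" using bm q1 by (intro mult_strict_left_mono) auto
        also have "\<dots> = 1" using q1 by (simp add: powr_add[symmetric])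
        finally show False by simp
      next
        case False
        have "1 \<le> \<bar>real_of_int (P * q - p * Q)\<bar>" using False by linarith
        then have "1 \<le> \<bar>real_of_int P * q - p * Q\<bar>" by simp
        also have "real_of_int P * q - p * Q = Q * q * (\<xi> - p / q) - q * (Q * \<xi> - P)"
          using pq(1) by (simp add: field_simps)
        also have "\<bar>\<dots>\<bar> \<le> Q * q * \<bar>\<xi> - p / q\<bar> + q * \<bar>Q * \<xi> - P\<bar>"
          using abs_triangle_ineq4[of "Q * q * (\<xi> - p / q)" "q * (Q * \<xi> - P)"] pq(1) PQ(1)
          by (simp only: abs_mult) simp
        also have "\<dots> \<le> Q * q * \<bar>\<xi> - p / q\<bar> + q * (C / x ^ n)"
          using PQ q1 by (intro add_left_mono mult_left_mono) auto
        also have "q * (C / x ^ n) \<le> 1 / 2" using xn x C q1 by (simp add: field_simps)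
        finally have "1 / 2 \<le> Q * q * \<bar>\<xi> - p / q\<bar>" by simp
        also have "\<dots> \<le> (C * (2 * C * q)) * q * \<bar>\<xi> - p / q\<bar>"
        proof -
          have "C * x ^ d \<le> C * (2 * C * q)" using xd C by (intro mult_left_mono) auto
          then show ?thesis using PQ(2) q1 by (intro mult_right_mono) auto
        qed
        also have "\<dots> < (C * (2 * C * q)) * q * q powr (- \<mu>)"
          using pq(2) C q1 by (intro mult_strict_left_mono) auto
        finally have "1 < (4 * C\<^sup>2) * (q powr 2 * q powr (- \<mu>))" using q1 by (simp add: power2_eq_square field_simps)
        also have "\<dots> < q powr (\<mu> - 2) * (q powr 2 * q powr (- \<mu>))" using b2 q1 by (intro mult_strict_right_mono) auto
        also have "\<dots> = 1" using q1 by (simp add: powr_add[symmetric] del: powr_numeral)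
        finally show False by simp
      qed
    qed
    have "?S \<subseteq> {y :: real. \<exists>p q :: int. 0 < q \<and> real_of_int q \<le> K \<and> y = real_of_int p / real_of_int q \<and> \<bar>\<xi> - y\<bar> < 1}"
    proof
      fix y assume "y \<in> ?S"
      then obtain p q :: int where pq: "0 < q" "y = p / q" "\<bar>\<xi> - y\<bar> < real_of_int q powr (- \<mu>)" by blast
      have "real_of_int q powr (- \<mu>) \<le> real_of_int q powr 0" using pq(1) mu m by (intro powr_mono) auto
      then have "\<bar>\<xi> - y\<bar> < 1" using pq by auto
      then show "y \<in> {y :: real. \<exists>p q :: int. 0 < q \<and> real_of_int q \<le> K \<and> y = real_of_int p / real_of_int q \<and> \<bar>\<xi> - y\<bar> < 1}"
        using pq small by blast
    qed
    then show False using inf finite_rationals_bounded_denominator finite_subset by blast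
  qed
qed

text \<open>For \<open>\<xi> = p / q\<close> the number \<open>q * (Q * \<xi> - P)\<close> is an
  integer. The lower bound keeps it nonzero, while a large \<open>v\<close> forces it below 1 in
  absolute value.\<close>

lemma irrational_if_sharply_approximable:
  assumes C: "0 < C" and ex: "\<And>K. \<exists>u v. K \<le> v \<and> sharply_approximable \<xi> C u v"
  shows "\<xi> \<notin> \<rat>"
proof
  assume "\<xi> \<in> \<rat>"
  then obtain p q :: int where pq: "0 < q" "\<xi> = p / q"
    by (metis Rats_cases' )
  obtain u v where uv: "2 * C * q \<le> v" "sharply_approximable \<xi> C u v" using ex by blast
  have q: "1 \<le> real_of_int q" using pq(1) by linarith
  have v: "0 < v" using uv(1) C q by (smt (verit) mult_pos_pos)
  from uv(2) obtain P Q :: int where PQ: "\<bar>Q * \<xi> - P\<bar> \<le> C / v"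
        "1 / (C * v) \<le> \<bar>Q * \<xi> - P\<bar>" unfolding sharply_approximable_def by blast
  have e: "real_of_int q * (Q * \<xi> - P) = real_of_int (Q * p - q * P)" using pq by (simp add: field_simps)
  have "0 < 1 / (C * v)" using C v by simp
  then have "Q * \<xi> - P \<noteq> 0" using PQ(2) by linarith
  then have "Q * p - q * P \<noteq> 0" using e q by (metis mult_eq_0_iff of_int_0 not_one_le_zero)
  then have "1 \<le> \<bar>real_of_int (Q * p - q * P)\<bar>" by linarith
  also have "\<dots> = q * \<bar>Q * \<xi> - P\<bar>" unfolding e[symmetric] using q by (simp add: abs_mult)
  also have "\<dots> \<le> q * (C / v)" using PQ(1) q by (intro mult_left_mono) auto
  also have "\<dots> \<le> 1 / 2" using uv(1) v by (simp add: field_simps)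
  finally show False by simp
qed

lemma irrationality_exponent_ge:
  assumes irr: "\<xi> \<notin> \<rat>" and x: "1 < x" and C: "1 \<le> C" and m: "1 < m"
    and ex: "\<And>D. \<exists>d n :: nat. D \<le> d \<and> approximable \<xi> C (x ^ d) (x ^ n) \<and> (m - 1) * real d \<le> real n"
  shows "ereal m \<le> irrationality_exponent \<xi>"
proof (rule dense_le)
  fix w :: ereal assume w: "w < ereal m"
  then have "max w 1 < ereal m" using m by (simp add: one_ereal_def)
  then obtain \<mu> where mu: "max w 1 < ereal \<mu>" "ereal \<mu> < ereal m"
    using ereal_dense2 by blast
  then have mu1: "1 < \<mu>" "\<mu> < m" "w \<le> ereal \<mu>" by (auto simp: one_ereal_def)
  let ?S = "{y. \<exists>p q :: int. 0 < q \<and> y = real_of_int p / real_of_int q \<and>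
                                     \<bar>\<xi> - y\<bar> < real_of_int q powr (- \<mu>)}"
  \<comment> \<open>Solutions arbitrarily close to \<open>\<xi>\<close> suffice, since an irrational
    number has positive distance from every finite set of rationals. \<open>D1\<close> absorbs the
    constants into the room between \<open>\<mu>\<close> and \<open>m\<close>; \<open>D2\<close>
    enforces the closeness.\<close>
  have ex2: "\<exists>y\<in>?S. \<bar>\<xi> - y\<bar> < e" if e: "0 < e" for e
  proof -
    obtain D1 where D1: "C * C powr (\<mu> - 1) < (x powr (m - \<mu>)) ^ D1"
      using real_arch_pow[of "x powr (m - \<mu>)"] x mu1 by auto
    obtain D2 where D2: "C / e < (x powr (m - 1)) ^ D2"
      using real_arch_pow[of "x powr (m - 1)"] x mu1 by auto
    obtain d n :: nat where dn: "max D1 D2 \<le> d" "approximable \<xi> C (x ^ d) (x ^ n)" "(m - 1) * real d \<le> real n"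
      using ex by blast
    obtain P Q :: int where PQ: "0 < Q" "real_of_int Q \<le> C * x ^ d" "\<bar>Q * \<xi> - P\<bar> \<le> C / x ^ n"
      using dn(2) unfolding approximable_def by blast
    have Q: "1 \<le> real_of_int Q" using PQ(1) by linarith
    have eq: "\<bar>\<xi> - P / Q\<bar> = \<bar>Q * \<xi> - P\<bar> / Q" using PQ(1) by (simp add: field_simps abs_divide flip: abs_of_pos)
    have xn: "x powr ((m - 1) * d) \<le> x ^ n"
    proof -
      have "x powr ((m - 1) * d) \<le> x powr n" using dn(3) x by simp
      then show ?thesis using x by (simp add: powr_realpow)
    qed
    have pw: "(x powr t) ^ d = x powr (t * d)" for t using x by (simp add: powr_realpow[symmetric] powr_powr)
    have "\<bar>\<xi> - P / Q\<bar> < e"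
    proof -
      have "C / e < (x powr (m - 1)) ^ d"
      proof -
        have "(x powr (m - 1)) ^ D2 \<le> (x powr (m - 1)) ^ d" using dn(1) x mu1 ge_one_powr_ge_zero[of x "m - 1"]
          by (intro power_increasing) auto
        then show ?thesis using D2 by linarith
      qed
      then have "C / e < x ^ n" using xn unfolding pw by linarith
      then have "C / x ^ n < e" using e x by (simp add: field_simps)
      moreover have "\<bar>Q * \<xi> - P\<bar> / Q \<le> \<bar>Q * \<xi> - P\<bar> / 1" using Q by (intro divide_left_mono) auto
      ultimately show ?thesis unfolding eq using PQ(3) by simp
    qed
    moreover have "\<bar>\<xi> - P / Q\<bar> < Q powr (- \<mu>)"
    proof -
      have "C * Q powr (\<mu> - 1) \<le> C * (C * x ^ d) powr (\<mu> - 1)" using PQ Q mu1 C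
        by (intro mult_left_mono powr_mono2) auto
      also have "\<dots> = C * C powr (\<mu> - 1) * x powr (d * (\<mu> - 1))" using C x
        by (simp add: powr_mult powr_realpow[symmetric] powr_powr)
      also have "\<dots> < (x powr (m - \<mu>)) ^ d * x powr (d * (\<mu> - 1))"
      proof (rule mult_strict_right_mono)
        have "(x powr (m - \<mu>)) ^ D1 \<le> (x powr (m - \<mu>)) ^ d" using dn(1) x mu1 ge_one_powr_ge_zero[of x "m - \<mu>"]
          by (intro power_increasing) auto
        then show "C * C powr (\<mu> - 1) < (x powr (m - \<mu>)) ^ d" using D1 by linarith
      qed (use x in auto)
      also have "\<dots> = x powr ((m - 1) * d)" unfolding pw by (simp add: powr_add[symmetric] algebra_simps)
      also have "\<dots> \<le> x ^ n" by (rule xn)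
      finally have "C / x ^ n < Q powr (- (\<mu> - 1))" unfolding powr_minus using x Q by (simp add: field_simps)
      then have "\<bar>Q * \<xi> - P\<bar> < Q powr (- (\<mu> - 1))" using PQ(3) by linarith
      then have "\<bar>Q * \<xi> - P\<bar> / Q < Q powr (- (\<mu> - 1)) / Q" using Q by (intro divide_strict_right_mono) auto
      also have "\<dots> = Q powr (- \<mu>)" using Q powr_diff[of Q "- (\<mu> - 1)" 1] by (simp add: algebra_simps)
      finally show ?thesis unfolding eq .
    qed
    ultimately show ?thesis using PQ(1) by blast
  qed
  have "infinite ?S"
  proof
    assume fin: "finite ?S"
    define e where "e = Min ((\<lambda>y. \<bar>\<xi> - y\<bar>) ` ?S)"
    have ne: "?S \<noteq> {}" using ex2[OF zero_less_one] by blast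
    have "0 < \<bar>\<xi> - y\<bar>" if "y \<in> ?S" for y
      using that irr by fastforce
    then have "0 < e" unfolding e_def using fin ne by (subst Min_gr_iff) auto
    then obtain y where "y \<in> ?S" "\<bar>\<xi> - y\<bar> < e" using ex2 by blast
    moreover have "e \<le> \<bar>\<xi> - y\<bar>" unfolding e_def using fin \<open>y \<in> ?S\<close> by (intro Min_le) auto
    ultimately show False by simp
  qed
  then have "ereal \<mu> \<le> irrationality_exponent \<xi>" unfolding irrationality_exponent_def
    by (intro Sup_upper) auto
  then show "w \<le> irrationality_exponent \<xi>" using mu1(3) by (rule order_trans[rotated])
qed

section \<open>Values of binary words\<close>

definition binary :: "nat list \<Rightarrow> bool" where
  "binary L \<longleftrightarrow> (\<forall>c\<in>set L. c \<le> 1)"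

lemma binary_simps [simp]:
  "binary []" "binary (c # L) \<longleftrightarrow> c \<le> 1 \<and> binary L" "binary (L @ R) \<longleftrightarrow> binary L \<and> binary R"
  unfolding binary_def by auto

locale integer_bases =
  fixes B A :: int
  assumes B: "2 \<le> B" and A: "1 \<le> A"
begin

text \<open>\<open>nm L / wt L\<close> is the sum of the terms of the series contributed by
  \<open>L\<close>, and \<open>1 / wt L\<close> is the factor that \<open>L\<close> puts on
  everything behind it.\<close>

primrec wt :: "nat list \<Rightarrow> int" where
  "wt [] = 1"
| "wt (c # L) = B * A ^ c * wt L"

primrec nm :: "nat list \<Rightarrow> int" where
  "nm [] = 0"
| "nm (c # L) = int c * wt L + nm L"

text \<open>The value of the word \<open>L\<close> followed by a word of value \<open>y\<close>.\<close>

definition act :: "nat list \<Rightarrow> real \<Rightarrow> real" where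
  "act L y = (real_of_int (nm L) + y) / real_of_int (wt L)"

definition cyl :: "nat list \<Rightarrow> real set" where
  "cyl L = act L ` {0..1}"

lemma wt_append [simp]: "wt (L @ R) = wt L * wt R"
  by (induction L) auto

lemma nm_append: "nm (L @ R) = nm L * wt R + nm R"
  by (induction L) (auto simp: algebra_simps)

lemma wt_eq: "wt L = B ^ length L * A ^ sum_list L"
  by (induction L) (auto simp: power_add)

lemma wt_pos [simp]: "0 < wt L"
  using B A by (simp add: wt_eq)

lemma wt_nonzero [simp]: "wt L \<noteq> 0"
  using wt_pos[of L] by linarith

lemma wt_nonneg [simp]: "0 \<le> wt L"
  using wt_pos[of L] by linarith

lemma wt_ge_1: "1 \<le> wt L"
  using wt_pos[of L] by linarith

lemma wt_ge_2: "L \<noteq> [] \<Longrightarrow> 2 \<le> wt L"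
proof (cases L)
  case (Cons c R)
  have "2 * 1 * 1 \<le> B * A ^ c * wt R" using B A wt_ge_1[of R] by (intro mult_mono one_le_power) auto
  then show ?thesis using Cons by simp
qed auto

lemma act_Nil [simp]: "act [] y = y"
  by (simp add: act_def)

lemma act_append [simp]: "act (L @ R) y = act L (act R y)"
  by (simp add: act_def nm_append field_simps)

lemma act_diff: "act L y - act L z = (y - z) / wt L"
  by (simp add: act_def field_simps)

lemma act_inject [simp]: "act L y = act L z \<longleftrightarrow> y = z"
  by (auto simp: act_def)

lemma nm_nonneg: "0 \<le> nm L"
  by (induction L) (auto intro!: add_nonneg_nonneg mult_nonneg_nonneg less_imp_le[OF wt_pos])

lemma letter_weight: "c \<le> 1 \<Longrightarrow> int c + 1 \<le> B * A ^ c"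
proof -
  assume "c \<le> 1"
  have "2 * 1 \<le> B * A ^ c" using A B by (intro mult_mono one_le_power) auto
  then show ?thesis using \<open>c \<le> 1\<close> by linarith
qed

lemma nm_less_wt: "binary L \<Longrightarrow> nm L + 1 \<le> wt L"
proof (induction L)
  case (Cons c L)
  have "(int c + 1) * wt L \<le> B * A ^ c * wt L"
    using Cons letter_weight[of c] by (intro mult_right_mono) (auto intro: less_imp_le[OF wt_pos])
  then show ?case using Cons by (simp add: algebra_simps)
qed auto

text \<open>A single letter 0 creates the slack. For \<open>B = 2\<close> and \<open>A = 1\<close> a
  word consisting of ones only satisfies \<open>nm L + 1 = wt L\<close>.\<close>

lemma nm_less_wt_strict: "binary L \<Longrightarrow> 0 \<in> set L \<Longrightarrow> nm L + 1 < wt L"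
proof (induction L)
  case (Cons c L)
  have IH: "nm L + 1 \<le> wt L" using Cons nm_less_wt by auto
  show ?case
  proof (cases "c = 0")
    case True
    have "2 * wt L \<le> B * wt L" using B by (intro mult_right_mono) (auto intro: less_imp_le[OF wt_pos])
    moreover have "nm (c # L) = nm L" "wt (c # L) = B * wt L" using True by auto
    ultimately show ?thesis using IH wt_pos[of L] by linarith
  next
    case False
    then have "0 \<in> set L" using Cons by auto
    have "(int c + 1) * wt L \<le> B * A ^ c * wt L"
      using Cons letter_weight[of c] by (intro mult_right_mono) (auto intro: less_imp_le[OF wt_pos])
    then show ?thesis using Cons \<open>0 \<in> set L\<close> by (simp add: algebra_simps)
  qed
qed auto

lemma act_unit: "binary L \<Longrightarrow> y \<in> {0..1} \<Longrightarrow> act L y \<in> {0..1}"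
proof -
  assume "binary L" "y \<in> {0..1}"
  moreover have "real_of_int (nm L + 1) \<le> real_of_int (wt L)" "0 \<le> real_of_int (nm L)"
    using nm_less_wt[OF \<open>binary L\<close>] nm_nonneg[of L] by linarith+
  ultimately show ?thesis by (simp add: act_def)
qed

lemma cyl_unit: "binary L \<Longrightarrow> cyl L \<subseteq> {0..1}"
  using act_unit by (auto simp: cyl_def)

lemma cyl_Nil [simp]: "cyl [] = {0..1}"
  by (simp add: cyl_def)

lemma cyl_append: "cyl (L @ R) = act L ` cyl R"
  by (auto simp: cyl_def)

lemma cyl_prefix:
  assumes "prefix L R" "binary R"
  shows "cyl R \<subseteq> cyl L"
proof -
  obtain R' where R: "R = L @ R'" using assms(1) by (auto simp: prefix_def)
  then have "cyl R' \<subseteq> {0..1}" using assms(2) by (intro cyl_unit) simp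
  then show ?thesis unfolding R cyl_append by (auto simp: cyl_def)
qed

lemma cyl_appendE:
  assumes "y \<in> cyl (L @ R)"
  obtains z where "z \<in> cyl R" "y = act L z"
  using assms unfolding cyl_append by auto

lemma cyl_prefixE:
  assumes "y \<in> cyl S" "prefix (L @ R) S" "binary S"
  obtains z where "z \<in> cyl R" "y = act L z"
  using assms cyl_prefix[of "L @ R" S] unfolding cyl_append by blast

lemma cyl_diff_upper:
  assumes "binary Z" "y \<in> cyl (L @ Z)" "z \<in> cyl (R @ Z)" "wt R = wt L" "\<bar>nm L - nm R\<bar> = B - 1"
  shows "\<bar>y - z\<bar> \<le> B / wt L"
proof -
  obtain u where u: "u \<in> cyl Z" "y = act L u" using assms by (auto elim: cyl_appendE)
  obtain v where v: "v \<in> cyl Z" "z = act R v" using assms by (auto elim: cyl_appendE)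
  have "u \<in> {0..1}" "v \<in> {0..1}" using u v cyl_unit[OF assms(1)] by auto
  moreover have "\<bar>real_of_int (nm L - nm R)\<bar> = B - 1" using assms(5) by linarith
  ultimately have "\<bar>real_of_int (nm L - nm R) + (u - v)\<bar> \<le> B" by auto
  moreover have "y - z = (real_of_int (nm L - nm R) + (u - v)) / wt L"
    unfolding u v act_def assms(4) by (simp add: diff_divide_distrib add_divide_distrib)
  moreover have "0 < real_of_int (wt L)" by simp
  ultimately show ?thesis by (simp only: abs_divide abs_of_pos divide_right_mono less_imp_le)
qed

text \<open>Both tails lie in the interval from 0 to \<open>1 - 1 / wt Z\<close> because
  \<open>Z\<close> contains a 0. Hence they differ by at most \<open>1 - 1 / wt Z\<close> and cannot
  cancel the numerator difference \<open>B - 1\<close>, even for \<open>B = 2\<close>.\<close>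

lemma cyl_diff_lower:
  assumes "binary Z" "y \<in> cyl (L @ Z)" "z \<in> cyl (R @ Z)" "wt R = wt L" "\<bar>nm L - nm R\<bar> = B - 1"
    and "0 \<in> set Z"
  shows "1 / wt Z / wt L \<le> \<bar>y - z\<bar>"
proof -
  obtain u where u: "u \<in> cyl Z" "y = act L u" using assms by (auto elim: cyl_appendE)
  obtain v where v: "v \<in> cyl Z" "z = act R v" using assms by (auto elim: cyl_appendE)
  have strict: "real_of_int (nm Z) + 1 \<le> wt Z - 1" using nm_less_wt_strict[OF assms(1,6)] by linarith
  have bound: "0 \<le> w \<and> w \<le> 1 - 1 / wt Z" if w: "w \<in> cyl Z" for w
  proof -
    obtain t where t: "t \<in> {0..1}" "w = act Z t" using w by (auto simp: cyl_def)
    have "w \<le> (wt Z - 1) / wt Z" unfolding t act_def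
      using strict t(1) wt_pos[of Z] by (intro divide_right_mono) (auto intro: less_imp_le)
    then have "w \<le> 1 - 1 / wt Z" by (simp add: diff_divide_distrib)
    moreover have "0 \<le> w" using w cyl_unit[OF assms(1)] by auto
    ultimately show ?thesis by simp
  qed
  have d: "\<bar>real_of_int (nm L - nm R)\<bar> = B - 1" using assms(5) by linarith
  have "1 \<le> real_of_int (B - 1)" using B by linarith
  then have "1 / wt Z \<le> \<bar>real_of_int (nm L - nm R) + (u - v)\<bar>" using bound[OF u(1)] bound[OF v(1)] d
    by linarith
  moreover have "y - z = (real_of_int (nm L - nm R) + (u - v)) / wt L"
    unfolding u v act_def assms(4) by (simp add: diff_divide_distrib add_divide_distrib)
  moreover have "0 < real_of_int (wt L)" by simp
  ultimately show ?thesis by (simp only: abs_divide abs_of_pos divide_right_mono less_imp_le)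
qed

text \<open>The approximation to the value of \<open>U\<close> followed by \<open>y\<close> is the value of the periodic word \<open>U V V V \<dots>\<close>\<close>

lemma approximable_periodic:
  fixes C u v :: real
  assumes "V \<noteq> []" "\<xi> = act U y" "wt U * wt V \<le> C * u" "wt V * \<bar>y - act V y\<bar> \<le> C / v"
  shows "approximable \<xi> C u v"
    and "1 / (C * v) \<le> wt V * \<bar>y - act V y\<bar> \<Longrightarrow> sharply_approximable \<xi> C u v"
proof -
  \<comment> \<open>The fixed point of \<open>act V\<close> is \<open>nm V / (wt V - 1)\<close>, and
    \<open>act U\<close> maps it to \<open>P / Q\<close>.\<close>
  define Q where "Q = wt U * (wt V - 1)"
  define P where "P = nm U * (wt V - 1) + nm V"
  have "0 < Q" using wt_ge_2[OF assms(1)] unfolding Q_def by simp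
  moreover have "real_of_int Q \<le> C * u"
  proof -
    have "Q \<le> wt U * wt V" unfolding Q_def by (simp add: algebra_simps less_imp_le)
    then have "real_of_int Q \<le> wt U * wt V" by (metis of_int_le_iff of_int_mult)
    then show ?thesis using assms(3) by linarith
  qed
  moreover have "\<bar>Q * \<xi> - P\<bar> = wt V * \<bar>y - act V y\<bar>"
  proof -
    have "Q * \<xi> = (wt V - 1) * (wt U * \<xi>)" by (simp add: Q_def)
    also have "wt U * \<xi> = nm U + y" unfolding assms(2) act_def by simp
    finally have "Q * \<xi> - P = wt V * y - (nm V + y)" unfolding P_def by (simp add: algebra_simps)
    also have "nm V + y = wt V * act V y" unfolding act_def by simp
    finally have "Q * \<xi> - P = wt V * (y - act V y)" by (simp add: algebra_simps)
    then show ?thesis using wt_pos[of V] by (simp add: abs_mult less_imp_le)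
  qed
  ultimately have PQ: "0 < Q" "real_of_int Q \<le> C * u" "\<bar>Q * \<xi> - P\<bar> = wt V * \<bar>y - act V y\<bar>" by auto
  then show "approximable \<xi> C u v"
    using assms(4) unfolding approximable_def by metis
  show "1 / (C * v) \<le> wt V * \<bar>y - act V y\<bar> \<Longrightarrow> sharply_approximable \<xi> C u v"
    using PQ assms(4) unfolding sharply_approximable_def by metis
qed

section \<open>The series of a binary word as an iterated action of its letters\<close>

abbreviation value_of :: "(nat \<Rightarrow> nat) \<Rightarrow> real" where
  "value_of w \<equiv> xi w (1 / B) (1 / A)"

lemma term_bound:
  assumes "w (Suc n) \<le> 1"
  shows "0 \<le> real (w (Suc n)) * (1 / real_of_int B) ^ Suc n * (1 / real_of_int A) ^ k"
    and "real (w (Suc n)) * (1 / real_of_int B) ^ Suc n * (1 / real_of_int A) ^ k \<le> (1 / 2) ^ Suc n"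
proof -
  have BA: "0 < real_of_int B" "0 < real_of_int A" "2 \<le> real_of_int B" "1 \<le> real_of_int A" using B A by linarith+
  then show "0 \<le> real (w (Suc n)) * (1 / real_of_int B) ^ Suc n * (1 / real_of_int A) ^ k" by simp
  have "real (w (Suc n)) * (1 / real_of_int B) ^ Suc n * (1 / real_of_int A) ^ k \<le> 1 * (1 / 2) ^ Suc n * 1"
    using assms BA by (intro mult_mono power_mono power_le_one) (auto intro!: divide_left_mono)
  then show "real (w (Suc n)) * (1 / real_of_int B) ^ Suc n * (1 / real_of_int A) ^ k \<le> (1 / 2) ^ Suc n" by simp
qed

lemma summable_value:
  assumes "\<And>n. w (Suc n) \<le> 1"
  shows "summable (\<lambda>n. real (w (Suc n)) * (1 / real_of_int B) ^ Suc n * (1 / real_of_int A) ^ (\<Sum>h=1..Suc n. w h))"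
proof (rule summable_comparison_test'[where N = 0 and g = "\<lambda>n. (1 / 2 :: real) ^ Suc n"])
  show "summable (\<lambda>n. (1 / 2 :: real) ^ Suc n)" by (simp only: summable_Suc_iff) (rule summable_geometric, simp)
  show "norm (real (w (Suc n)) * (1 / real_of_int B) ^ Suc n * (1 / real_of_int A) ^ (\<Sum>h=1..Suc n. w h)) \<le> (1 / 2) ^ Suc n" for n
    using term_bound[of w n "\<Sum>h=1..Suc n. w h"] assms by (simp only: real_norm_def abs_of_nonneg)
qed

lemma value_unit:
  assumes "\<And>n. w (Suc n) \<le> 1"
  shows "value_of w \<in> {0..1}"
proof -
  have g: "(\<lambda>n. (1 / 2 :: real) ^ Suc n) sums 1"
    using power_half_series by simp
  have "value_of w \<le> (\<Sum>n. (1 / 2 :: real) ^ Suc n)"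
    unfolding xi_def by (intro suminf_le summable_value assms sums_summable[OF g] term_bound)
  also have "\<dots> = 1" using g by (simp add: sums_iff)
  finally have "value_of w \<le> 1" .
  moreover have "0 \<le> value_of w" unfolding xi_def by (intro suminf_nonneg summable_value assms term_bound)
  ultimately show ?thesis by simp
qed

lemma value_Cons:
  assumes "\<And>n. w (Suc n) \<le> 1"
  shows "value_of w = act [w 1] (value_of (\<lambda>n. w (Suc n)))"
proof -
  define f where "f = (\<lambda>w n. real (w (Suc n)) * (1 / real_of_int B) ^ Suc n * (1 / real_of_int A) ^ (\<Sum>h=1..Suc n. w h))"
  have xi: "value_of w = suminf (f w)" for w unfolding xi_def f_def ..
  have BA: "0 < real_of_int B" "0 < real_of_int A" using B A by linarith+
  have sm: "summable (f w)" "summable (f (\<lambda>n. w (Suc n)))" unfolding f_def using assms by (intro summable_value; simp)+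
  have step: "f w (Suc n) = f (\<lambda>n. w (Suc n)) n * (1 / (B * A ^ w 1))" for n
  proof -
    have "(\<Sum>h=1..Suc (Suc n). w h) = w 1 + (\<Sum>h=1..Suc n. w (Suc h))"
      using sum.atLeast_Suc_atMost[of 1 "Suc (Suc n)" w] sum.shift_bounds_cl_Suc_ivl[of w 1 "Suc n"] by simp
    then show ?thesis unfolding f_def by (simp add: power_add power_divide)
  qed
  have "suminf (f w) = f w 0 + (\<Sum>n. f w (Suc n))" using suminf_split_head[OF sm(1)] by simp
  also have "(\<Sum>n. f w (Suc n)) = suminf (f (\<lambda>n. w (Suc n))) * (1 / (B * A ^ w 1))"
    unfolding step by (rule suminf_mult2[symmetric, OF sm(2)])
  also have "f w 0 = w 1 * (1 / (B * A ^ w 1))" unfolding f_def by (simp add: power_divide)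
  finally show ?thesis unfolding xi act_def using BA by (simp add: add_divide_distrib)
qed

lemma value_prefix:
  assumes "\<And>n. w (Suc n) \<le> 1" "\<And>i. i < length L \<Longrightarrow> w (Suc i) = L ! i"
  shows "value_of w = act L (value_of (\<lambda>n. w (n + length L)))"
  using assms
proof (induction L arbitrary: w)
  case (Cons c L)
  have c: "w 1 = c" using Cons.prems(2)[of 0] by simp
  have "value_of (\<lambda>n. w (Suc n)) = act L (value_of (\<lambda>n. w (Suc (n + length L))))"
    using Cons.prems by (intro Cons.IH) force+
  moreover have "act (c # L) y = act [c] (act L y)" for y using act_append[of "[c]" L] by simp
  ultimately show ?case using value_Cons[of w] Cons.prems(1) c by simp
qed simp

text \<open>Behind position \<open>m\<close> the letters agree, and the two beginnings have equal
  weight because both length and letter sum agree. So the values differ by a rational with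
  denominator \<open>wt L\<close>.\<close>

lemma value_eventually_equal_sums:
  assumes w: "\<And>n. w (Suc n) \<le> 1" and w': "\<And>n. w' (Suc n) \<le> 1"
    and eq: "\<And>n. m \<le> n \<Longrightarrow> (\<Sum>h=1..n. w h) = (\<Sum>h=1..n. w' h)"
  obtains g c :: int where "0 < g" "value_of w' = (g * value_of w + c) / g"
proof -
  define L where "L = map (\<lambda>i. w (Suc i)) [0..<m]"
  define L' where "L' = map (\<lambda>i. w' (Suc i)) [0..<m]"
  have tail: "w (n + m) = w' (n + m)" if "1 \<le> n" for n
    using eq[of "n + m"] eq[of "n + m - 1"] that by (cases n) auto
  have t: "value_of (\<lambda>n. w (n + m)) = value_of (\<lambda>n. w' (n + m))"
  proof -
    have "(\<Sum>h=1..Suc n. w (h + m)) = (\<Sum>h=1..Suc n. w' (h + m))" for n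
      using tail by (intro sum.cong) auto
    then show ?thesis unfolding xi_def using tail[of "Suc _"] by simp
  qed
  have len: "length L = m" "length L' = m" unfolding L_def L'_def by auto
  have e1: "value_of w = act L (value_of (\<lambda>n. w (n + length L)))"
    by (rule value_prefix) (use w in \<open>auto simp: L_def\<close>)
  have e2: "value_of w' = act L' (value_of (\<lambda>n. w' (n + length L')))"
    by (rule value_prefix) (use w' in \<open>auto simp: L'_def\<close>)
  have "sum_list L = (\<Sum>h=1..m. w h)" "sum_list L' = (\<Sum>h=1..m. w' h)"
    unfolding L_def L'_def by (simp_all add: interv_sum_list_conv_sum_set_nat sum.atLeast1_atMost_eq atLeast0LessThan)
  then have "wt L' = wt L" using eq[of m] len by (simp add: wt_eq)
  then have "value_of w' = (wt L * value_of w + (nm L' - nm L)) / wt L"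
    unfolding e1 e2 len t act_def by (simp add: field_simps)
  then show thesis using that[of "wt L" "nm L' - nm L"] by simp
qed

end

section \<open>Standard words and their Ostrowski splittings\<close>

definition pw :: "nat \<Rightarrow> 'a list \<Rightarrow> 'a list" where
  "pw n L = concat (replicate n L)"

lemma pw_simps [simp]: "pw 0 L = []" "pw (Suc n) L = L @ pw n L"
  by (auto simp: pw_def)

lemma pw_add: "pw (m + n) L = pw m L @ pw n L"
  by (induction m) auto

lemma pw_commute: "L @ pw n L = pw n L @ L"
  by (induction n) auto

lemma length_pw [simp]: "length (pw n L) = n * length L"
  by (induction n) auto

lemma sum_list_pw [simp]: "sum_list (pw n L) = n * sum_list L" for L :: "nat list"
  by (induction n) auto

lemma binary_pw [simp]: "binary L \<Longrightarrow> binary (pw n L)"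
  by (induction n) auto

lemma binary_replicate [simp]: "c \<le> 1 \<Longrightarrow> binary (replicate n c)"
  by (simp add: binary_def)

locale sturmian_word = integer_bases B A for B A +
  fixes \<theta> \<rho> :: real and a b :: "nat \<Rightarrow> nat"
  assumes \<theta>_pos: "0 < \<theta>" and \<theta>_less_1: "\<theta> < 1" and \<theta>_irrational: "\<theta> \<notin> \<rat>"
    and expansion: "cf_expansion \<theta> a"
    and \<rho>_nonneg: "0 \<le> \<rho>" and \<rho>_less_1: "\<rho> < 1"
    and digits: "ostrowski_digits \<theta> a (\<rho> - \<theta>) b"
begin

section \<open>Convergents and their distances to \<open>\<theta>\<close>\<close>

abbreviation p where "p \<equiv> cf_num a"
abbreviation q where "q \<equiv> cf_den a"

definition \<delta> :: "nat \<Rightarrow> real" where "\<delta> k = real (q k) * \<theta> - real (p k)"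

text \<open>The index is shifted by one so that the start value 1, the absolute value of the error
  belonging to the convergent of index -1, fits into the same recurrence.\<close>

definition gap :: "nat \<Rightarrow> real" where "gap k = (case k of 0 \<Rightarrow> 1 | Suc j \<Rightarrow> \<bar>\<delta> j\<bar>)"

lemma a_pos: "1 \<le> k \<Longrightarrow> 1 \<le> a k"
  using expansion by (auto simp: cf_expansion_def)

lemma b1: "b 1 < a 1" and b_le: "2 \<le> k \<Longrightarrow> b k \<le> a k"
  and b_full: "1 \<le> k \<Longrightarrow> b (Suc k) = a (Suc k) \<Longrightarrow> b k = 0"
  and b_sums: "(\<lambda>k. real (b (Suc k)) * \<delta> k) sums (\<rho> - \<theta>)"
  using digits by (auto simp: ostrowski_digits_def \<delta>_def)

lemma q_pos [simp]: "0 < q k"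
proof (induction k rule: induct_nat_012)
  case 1 then show ?case using a_pos[of 1] by simp
qed auto

lemma q_mono_Suc: "q k \<le> q (Suc k)"
proof (cases k)
  case 0 then show ?thesis using a_pos[of 1] by simp
next
  case (Suc j)
  have "1 * q (Suc j) \<le> a (Suc (Suc j)) * q (Suc j)" using a_pos[of "Suc (Suc j)"] by (intro mult_right_mono) auto
  then show ?thesis using Suc by (simp add: trans_le_add1)
qed

lemma q_mono: "i \<le> j \<Longrightarrow> q i \<le> q j"
  by (rule lift_Suc_mono_le[of q, OF q_mono_Suc])

lemma q_add_le: "q (Suc k) + q k \<le> q (Suc (Suc k))"
proof -
  have "1 * q (Suc k) \<le> a (Suc (Suc k)) * q (Suc k)" using a_pos by (intro mult_right_mono) auto
  then show ?thesis by simp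
qed

lemma q_ge: "k \<le> q k"
proof (induction k rule: induct_nat_012)
  case 1 then show ?case using q_pos[of 1] by simp
next
  case (ge2 n)
  have "q (Suc n) + q n \<le> q (Suc (Suc n))" by (rule q_add_le)
  moreover have "1 \<le> q n" using q_pos[of n] by linarith
  ultimately show ?case using ge2 by linarith
qed auto

lemma cf_det: "real (p (Suc k)) * q k - real (p k) * q (Suc k) = (-1) ^ k"
  by (induction k) (auto simp: algebra_simps)

lemma \<delta>_rec: "\<delta> (Suc (Suc k)) = a (Suc (Suc k)) * \<delta> (Suc k) + \<delta> k"
  by (simp add: \<delta>_def algebra_simps)

lemma convergent_step:
  "real (p (Suc (Suc k))) / q (Suc (Suc k)) - real (p k) / q k
     = (-1) ^ k * (a (Suc (Suc k)) / (q k * q (Suc (Suc k))))"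
proof -
  have q0: "real (q k) > 0" "real (q (Suc (Suc k))) > 0" using q_pos by (auto simp del: cf_den.simps)
  have "real (p (Suc (Suc k))) * q k - real (p k) * q (Suc (Suc k))
      = a (Suc (Suc k)) * (real (p (Suc k)) * q k - real (p k) * q (Suc k))"
    by (simp add: algebra_simps)
  then have "real (p (Suc (Suc k))) * q k - real (p k) * q (Suc (Suc k)) = real (a (Suc (Suc k))) * (-1) ^ k"
    unfolding cf_det .
  then show ?thesis using q0 by (simp add: diff_frac_eq mult.commute del: cf_den.simps cf_num.simps)
qed

lemma convergents_tendsto: "(\<lambda>k. real (p k) / real (q k)) \<longlonglongrightarrow> \<theta>"
  using expansion by (simp add: cf_expansion_def)

text \<open>Convergents of even index increase to \<open>\<theta>\<close> and those of odd index
  decrease to it; irrationality makes the inequalities strict.\<close>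

lemma \<delta>_sign: "0 < (-1) ^ k * \<delta> k"
proof -
  have q0: "0 < real (q k)" by simp
  have "0 \<le> (-1) ^ k * (\<theta> - real (p k) / q k)"
  proof (cases "even k")
    case True
    define f where "f = (\<lambda>i. real (p (2 * i)) / q (2 * i))"
    have "f \<longlonglongrightarrow> \<theta>"
      using LIMSEQ_subseq_LIMSEQ[OF convergents_tendsto, of "\<lambda>i. 2 * i"] by (simp add: f_def o_def strict_mono_def)
    moreover have "incseq f"
    proof (rule incseq_SucI)
      fix i show "f i \<le> f (Suc i)" using convergent_step[of "2 * i"] q_pos
        by (simp add: f_def del: cf_den.simps cf_num.simps) (smt (verit) divide_nonneg_nonneg mult_nonneg_nonneg of_nat_0_le_iff)
    qed
    ultimately have "f (k div 2) \<le> \<theta>" by (intro incseq_le)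
    then show ?thesis using True by (simp add: f_def)
  next
    case False
    define f where "f = (\<lambda>i. real (p (2 * i + 1)) / q (2 * i + 1))"
    have "f \<longlonglongrightarrow> \<theta>"
      using LIMSEQ_subseq_LIMSEQ[OF convergents_tendsto, of "\<lambda>i. 2 * i + 1"] by (simp add: f_def o_def strict_mono_def)
    moreover have "decseq f"
    proof (rule decseq_SucI)
      fix i show "f (Suc i) \<le> f i" using convergent_step[of "2 * i + 1"] q_pos
        by (simp add: f_def del: cf_den.simps cf_num.simps) (smt (verit) divide_nonneg_nonneg mult_nonneg_nonneg of_nat_0_le_iff)
    qed
    ultimately have "\<theta> \<le> f (k div 2)" by (intro decseq_ge)
    then show ?thesis using False by (simp add: f_def)
  qed
  moreover have "\<theta> \<noteq> real (p k) / q k" using \<theta>_irrational by (metis Rats_divide Rats_of_nat)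
  ultimately have "0 < (-1) ^ k * (\<theta> - real (p k) / q k)" by (smt (verit) mult_eq_0_iff power_eq_0_iff)
  then have "0 < q k * ((-1) ^ k * (\<theta> - real (p k) / q k))" using q0 by simp
  also have "\<dots> = (-1) ^ k * \<delta> k" using q0 by (simp add: \<delta>_def algebra_simps)
  finally show ?thesis .
qed

lemma gap_Suc: "gap (Suc k) = (-1) ^ k * \<delta> k"
  using \<delta>_sign[of k] by (cases "even k") (auto simp: gap_def)

lemma \<delta>_gap: "\<delta> k = (-1) ^ k * gap (Suc k)"
  unfolding gap_Suc by (simp add: power_mult_distrib[symmetric] flip: mult.assoc)

lemma gap_pos: "0 < gap k"
  using \<delta>_sign[of "k - 1"] gap_Suc[of "k - 1"] by (cases k) (auto simp: gap_def)

lemma gap_0: "gap 0 = 1" and gap_1: "gap (Suc 0) = \<theta>"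
  using \<theta>_pos by (auto simp: gap_def \<delta>_def)

lemma gap_rec: "gap k = a (Suc k) * gap (Suc k) + gap (Suc (Suc k))"
proof (cases k)
  case 0 then show ?thesis using gap_Suc[of 1] gap_1 gap_0 by (simp add: \<delta>_def)
next
  case (Suc j) then show ?thesis using \<delta>_rec[of j] by (simp add: gap_Suc algebra_simps)
qed

lemma gap_add_le: "gap (Suc k) + gap (Suc (Suc k)) \<le> gap k"
proof -
  have "1 * gap (Suc k) \<le> a (Suc k) * gap (Suc k)" using gap_pos a_pos[of "Suc k"] by (intro mult_right_mono) (auto simp: less_imp_le)
  then show ?thesis using gap_rec[of k] by simp
qed

lemma gap_le_1: "gap k \<le> 1"
proof (induction k)
  case (Suc k) then show ?case using gap_add_le[of k] gap_pos[of "Suc (Suc k)"] by linarith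
qed (simp add: gap_0)

lemma abs_\<delta>_le_1: "\<bar>\<delta> k\<bar> \<le> 1"
  using gap_le_1[of "Suc k"] by (simp add: gap_def)

section \<open>Standard words and the partial sums of their prefixes\<close>

fun Mw :: "nat \<Rightarrow> nat list" where
  "Mw 0 = [0]"
| "Mw (Suc 0) = replicate (a 1 - 1) 0 @ [1]"
| "Mw (Suc (Suc k)) = pw (a (Suc (Suc k))) (Mw (Suc k)) @ Mw k"

lemma length_Mw [simp]: "length (Mw k) = q k"
  using a_pos[of 1] by (induction k rule: Mw.induct) auto

lemma sum_Mw [simp]: "sum_list (Mw k) = p k"
  by (induction k rule: Mw.induct) (auto simp: sum_list_replicate)

lemma binary_Mw [simp]: "binary (Mw k)"
  by (induction k rule: Mw.induct) auto

lemma last_Mw: "\<exists>L. Mw k = L @ [if even k then 0 else 1]"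
proof (induction k rule: Mw.induct)
  case (3 k)
  then obtain L where "Mw k = L @ [if even k then 0 else 1]" by blast
  then show ?case by (auto intro: exI[of _ "pw (a (Suc (Suc k))) (Mw (Suc k)) @ L"])
qed auto

text \<open>The final position has to be treated apart: its deviation lies outside the margin from
  \<open>gap k\<close> to \<open>1 - gap k\<close> that holds at all earlier positions, since
  \<open>gap (Suc k) < gap k\<close>.\<close>

lemma sum_take_Mw_end:
  assumes "Suc n = q k"
  shows "real (Suc n) * \<theta> - sum_list (take n (Mw k)) = (if even k then gap (Suc k) else 1 - gap (Suc k))"
proof -
  obtain L where L: "Mw k = L @ [if even k then 0 else 1]" using last_Mw by blast
  define c :: nat where "c = (if even k then 0 else 1)"
  have Lc: "Mw k = L @ [c]" using L by (simp add: c_def)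
  then have "length L = n" using assms length_Mw[of k] by simp
  then have "sum_list (take n (Mw k)) + c = p k" using sum_Mw[of k] unfolding Lc by simp
  then have "real (sum_list (take n (Mw k))) = real (p k) - real c" by linarith
  then have "real (Suc n) * \<theta> - sum_list (take n (Mw k)) = \<delta> k + c" unfolding \<delta>_def assms by simp
  then show ?thesis by (simp add: c_def \<delta>_gap)
qed

text \<open>\<open>Mw k\<close> is a prefix of the characteristic word, with a quantitative margin that carries the induction.\<close>

lemma sum_take_Mw:
  "Suc n < q k \<Longrightarrow> real (Suc n) * \<theta> - sum_list (take n (Mw k)) \<in> {gap k .. 1 - gap k}"
proof (induction k arbitrary: n rule: Mw.induct)
  case 2
  then have n: "n < a 1 - 1" by simp
  have "real (Suc n) * \<theta> + \<theta> = real (n + 2) * \<theta>" by (simp add: algebra_simps)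
  also have "\<dots> \<le> real (a 1) * \<theta>" using n \<theta>_pos by (intro mult_right_mono) auto
  also have "\<dots> \<le> 1" using gap_rec[of 0] gap_0 gap_1 gap_pos[of 2] by (simp add: numeral_2_eq_2)
  finally have "real (Suc n) * \<theta> + \<theta> \<le> 1" .
  moreover have "\<theta> \<le> real (Suc n) * \<theta>" using \<theta>_pos by simp
  moreover have "take n (Mw (Suc 0)) = replicate n 0" using n by simp
  then have S: "sum_list (take n (Mw (Suc 0))) = 0" by (simp only: sum_list_replicate)
  ultimately show ?case unfolding S gap_1 by simp
next
  case (3 k)
  \<comment> \<open>Position \<open>n\<close> lies behind \<open>j\<close> complete copies of
    \<open>Mw (Suc k)\<close>, and each of them shifts the deviation by
    \<open>\<delta> (Suc k)\<close>.\<close>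
  define N where "N = q (Suc k)"
  define j where "j = n div N"
  define i where "i = n mod N"
  have N: "0 < N" unfolding N_def by simp
  have n: "n = j * N + i" "i < N" using N by (simp_all add: j_def i_def)
  define al where "al = a (Suc (Suc k))"
  have qk: "q (Suc (Suc k)) = al * N + q k" by (simp add: al_def N_def)
  have "j \<le> al"
  proof (rule ccontr)
    assume "\<not> j \<le> al"
    then have "Suc al * N \<le> j * N" by (intro mult_right_mono) auto
    then show False using 3(3) n qk q_mono_Suc[of k] by (simp add: N_def)
  qed
  have gr: "gap (Suc k) = al * gap (Suc (Suc k)) + gap (Suc (Suc (Suc k)))" unfolding al_def by (rule gap_rec)
  note gp = gap_pos[of "Suc (Suc k)"] gap_pos[of "Suc (Suc (Suc k))"] gap_add_le[of k] gap_le_1[of k]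
  have "\<bar>j * \<delta> (Suc k)\<bar> = j * gap (Suc (Suc k))" unfolding \<delta>_gap by (simp add: abs_mult gp(1) less_imp_le)
  then have jd: "- (j * gap (Suc (Suc k))) \<le> j * \<delta> (Suc k)" "j * \<delta> (Suc k) \<le> j * gap (Suc (Suc k))" by linarith+
  have split: "pw al (Mw (Suc k)) = pw j (Mw (Suc k)) @ pw (al - j) (Mw (Suc k))"
    using \<open>j \<le> al\<close> by (metis le_add_diff_inverse pw_add)
  have tk: "take n (Mw (Suc (Suc k))) = pw j (Mw (Suc k)) @ take i (pw (al - j) (Mw (Suc k)) @ Mw k)"
    unfolding Mw.simps al_def[symmetric] split n(1) by (simp add: N_def)
  show ?case
  proof (cases "j = al")
    case True
    have i: "Suc i < q k" using 3(3) n True qk by simp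
    have "sum_list (take n (Mw (Suc (Suc k)))) = j * p (Suc k) + sum_list (take i (Mw k))"
      unfolding tk using True by simp
    then have "real (Suc n) * \<theta> - sum_list (take n (Mw (Suc (Suc k))))
        = (real (Suc i) * \<theta> - sum_list (take i (Mw k))) + j * \<delta> (Suc k)"
      unfolding n(1) \<delta>_def N_def by (simp add: algebra_simps)
    then show ?thesis using 3(2)[OF i] jd gr gp unfolding True atLeastAtMost_iff by linarith
  next
    case False
    then have j: "j < al" using \<open>j \<le> al\<close> by simp
    have "take i (pw (al - j) (Mw (Suc k)) @ Mw k) = take i (Mw (Suc k))"
      using j n(2) by (cases "al - j") (auto simp: N_def)
    then have "sum_list (take n (Mw (Suc (Suc k)))) = j * p (Suc k) + sum_list (take i (Mw (Suc k)))"
      unfolding tk by simp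
    then have e: "real (Suc n) * \<theta> - sum_list (take n (Mw (Suc (Suc k))))
        = (real (Suc i) * \<theta> - sum_list (take i (Mw (Suc k)))) + j * \<delta> (Suc k)"
      unfolding n(1) \<delta>_def N_def by (simp add: algebra_simps)
    have "(real j + 1) * gap (Suc (Suc k)) \<le> al * gap (Suc (Suc k))"
      using j gp by (intro mult_right_mono) auto
    then have jal: "j * gap (Suc (Suc k)) + gap (Suc (Suc k)) \<le> al * gap (Suc (Suc k))" by (simp add: algebra_simps)
    show ?thesis
    proof (cases "Suc i < N")
      case True
      then have "real (Suc i) * \<theta> - sum_list (take i (Mw (Suc k))) \<in> {gap (Suc k)..1 - gap (Suc k)}"
        using 3(1)[of i] by (simp add: N_def)
      then show ?thesis using jd gr gp jal unfolding e atLeastAtMost_iff by linarith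
    next
      case False
      then have "Suc i = q (Suc k)" using n(2) by (simp add: N_def)
      note last = sum_take_Mw_end[OF this]
      \<comment> \<open>At the end of a copy the deviation is only \<open>gap (Suc (Suc k))\<close>
        away from 0 or from 1, but then the shift by \<open>j * \<delta> (Suc k)\<close> points away
        from that endpoint.\<close>
      show ?thesis
      proof (cases "even (Suc k)")
        case True
        then have "j * \<delta> (Suc k) = j * gap (Suc (Suc k))" unfolding \<delta>_gap by simp
        moreover have "0 \<le> j * gap (Suc (Suc k))" using gp by simp
        moreover have "real (Suc i) * \<theta> - sum_list (take i (Mw (Suc k))) = gap (Suc (Suc k))"
          using last True by (simp only: if_True)
        ultimately show ?thesis using gr gp jal unfolding e atLeastAtMost_iff by linarith
      next
        case False
        then have "j * \<delta> (Suc k) = - (j * gap (Suc (Suc k)))" unfolding \<delta>_gap by simp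
        moreover have "0 \<le> j * gap (Suc (Suc k))" using gp by simp
        moreover have "real (Suc i) * \<theta> - sum_list (take i (Mw (Suc k))) = 1 - gap (Suc (Suc k))"
          using last False by (simp only: if_False)
        ultimately show ?thesis using gr gp jal unfolding e atLeastAtMost_iff by linarith
      qed
    qed
  qed
qed simp

lemma sum_take_Mw_unit:
  "Suc n < q k \<Longrightarrow> real (Suc n) * \<theta> - sum_list (take n (Mw k)) \<in> {0..1}"
  using sum_take_Mw[of n k] gap_pos[of k] by auto

lemma prefix_Mw_Suc: "prefix (Mw (Suc k)) (Mw (Suc (Suc k)))"
  using a_pos[of "Suc (Suc k)"] by (cases "a (Suc (Suc k))") auto

lemma prefix_Mw: "1 \<le> i \<Longrightarrow> i \<le> j \<Longrightarrow> prefix (Mw i) (Mw j)"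
proof (induction j)
  case (Suc j)
  show ?case
  proof (cases "i = Suc j")
    case False
    then obtain j' where "j = Suc j'" "i \<le> j" using Suc.prems by (cases j) auto
    then show ?thesis using Suc.IH Suc.prems prefix_Mw_Suc prefix_order.order_trans by blast
  qed simp
qed simp

section \<open>The Ostrowski splitting of the standard words\<close>

fun Ww :: "nat \<Rightarrow> nat list" where
  "Ww 0 = [0]"
| "Ww (Suc 0) = replicate (a 1 - b 1 - 1) 0 @ [1]"
| "Ww (Suc (Suc k)) =
     (if b (Suc (Suc k)) < a (Suc (Suc k))
      then Ww (Suc k) @ pw (a (Suc (Suc k)) - b (Suc (Suc k)) - 1) (Mw (Suc k)) @ Mw k
      else Ww k)"

fun Xw :: "nat \<Rightarrow> nat list" where
  "Xw 0 = []"
| "Xw (Suc 0) = replicate (b 1) 0"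
| "Xw (Suc (Suc k)) = pw (b (Suc (Suc k))) (Mw (Suc k)) @ Xw (Suc k)"

text \<open>If the digit is not full, the first \<open>b\<close> copies of \<open>Mw (Suc k)\<close>
  go to \<open>Xw\<close> and the next copy is itself split. If it is full, all copies go to
  \<open>Xw\<close>, and the preceding digit 0 gives \<open>Xw (Suc k) = Xw k\<close>, so the
  remaining factor \<open>Mw k\<close> is split as before.\<close>

lemma Mw_split: "Mw k = Xw k @ Ww k"
proof (induction k rule: Mw.induct)
  case 2
  have "a 1 - 1 = b 1 + (a 1 - b 1 - 1)" using b1 by simp
  then show ?case by (simp add: replicate_add[symmetric])
next
  case (3 k)
  let ?a = "a (Suc (Suc k))" and ?b = "b (Suc (Suc k))"
  show ?case
  proof (cases "?b < ?a")
    case True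
    then have "?a = ?b + Suc (?a - ?b - 1)" by simp
    then have "Mw (Suc (Suc k)) = pw ?b (Mw (Suc k)) @ Mw (Suc k) @ pw (?a - ?b - 1) (Mw (Suc k)) @ Mw k"
      unfolding Mw.simps by (metis append.assoc pw_add pw_simps(2))
    then show ?thesis using 3(1) True by simp
  next
    case False
    then have eq: "?b = ?a" using b_le[of "Suc (Suc k)"] by simp
    then have "b (Suc k) = 0" using b_full[of "Suc k"] by simp
    then have "Xw (Suc k) = Xw k" by (cases k) auto
    then show ?thesis using eq 3(2) by simp
  qed
qed simp

lemma binary_Ww [simp]: "binary (Ww k)" and binary_Xw [simp]: "binary (Xw k)"
  using binary_Mw[of k] unfolding Mw_split by simp_all

lemma sum_Xw: "sum_list (Xw k) = (\<Sum>j<k. b (Suc j) * p j)"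
  by (induction k rule: Xw.induct) (auto simp: sum_list_replicate)

lemma length_Xw_sum: "length (Xw k) = (\<Sum>j<k. b (Suc j) * q j)"
  by (induction k rule: Xw.induct) auto

lemma ost_t_eq: "ost_t a b k = length (Xw k)"
  by (simp add: ost_t_def length_Xw_sum sum.atLeast1_atMost_eq)

lemma length_Xw_Ww: "length (Xw k) + length (Ww k) = q k"
  using length_Mw[of k] unfolding Mw_split by simp

lemma ost_r_eq: "ost_r a b k = int (length (Ww k))"
  using length_Xw_Ww[of k] by (simp add: ost_r_def ost_t_eq)

definition offset :: "nat \<Rightarrow> real" where
  "offset k = (\<Sum>j<k. real (b (Suc j)) * \<delta> j)"

lemma offset_eq: "offset k = length (Xw k) * \<theta> - sum_list (Xw k)"
  unfolding offset_def sum_Xw length_Xw_sum \<delta>_def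
  by (simp add: sum_subtractf sum_distrib_left sum_distrib_right algebra_simps)

lemma offset_tendsto: "offset \<longlonglongrightarrow> \<rho> - \<theta>"
  using b_sums unfolding sums_def offset_def .

section \<open>Full digits and the limit word\<close>

definition good :: "nat \<Rightarrow> bool" where
  "good k \<longleftrightarrow> b (Suc k) < a (Suc k)"

text \<open>Full digits are isolated: a full digit is positive, whereas the digit before a full one
  must be 0. Both neighbours of a non-good index are therefore good, and \<open>Ww\<close> and
  \<open>Xw\<close> merely skip over it.\<close>

lemma not_goodD:
  assumes "\<not> good (Suc k)"
  shows "b (Suc (Suc k)) = a (Suc (Suc k))" "b (Suc k) = 0" "good k" "good (Suc (Suc k))"
    "Ww (Suc (Suc k)) = Ww k" "Xw (Suc k) = Xw k"
proof -
  show 1: "b (Suc (Suc k)) = a (Suc (Suc k))" using assms b_le[of "Suc (Suc k)"] by (simp add: good_def)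
  then show 2: "b (Suc k) = 0" using b_full[of "Suc k"] by simp
  then show "good k" using a_pos[of "Suc k"] by (simp add: good_def)
  show "Ww (Suc (Suc k)) = Ww k" using 1 by simp
  show "Xw (Suc k) = Xw k" using 2 by (cases k) auto
  show "good (Suc (Suc k))"
  proof (rule ccontr)
    assume "\<not> ?thesis"
    then have "b (Suc (Suc (Suc k))) = a (Suc (Suc (Suc k)))" using b_le[of "Suc (Suc (Suc k))"] by (simp add: good_def)
    then have "b (Suc (Suc k)) = 0" using b_full[of "Suc (Suc k)"] by simp
    then show False using 1 a_pos[of "Suc (Suc k)"] by simp
  qed
qed

lemma Ww_good:
  assumes "good (Suc k)"
  shows "Ww (Suc (Suc k)) = Ww (Suc k) @ pw (a (Suc (Suc k)) - b (Suc (Suc k)) - 1) (Mw (Suc k)) @ Mw k"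
  using assms by (simp add: good_def)

text \<open>
  For good \<open>k\<close> the word \<open>Zw k\<close> is a prefix of the Sturmian word; \<open>Ww k\<close> alone does not suffice because its
  length can stay bounded.
\<close>

definition Zw :: "nat \<Rightarrow> nat list" where
  "Zw k = Ww k @ Mw (k - 1)"

lemma binary_Zw [simp]: "binary (Zw k)"
  by (simp add: Zw_def)

lemma length_Zw: "k - 1 \<le> length (Zw k)"
  using q_ge[of "k - 1"] by (simp add: Zw_def)

lemma prefix_Zw_good:
  assumes "good (Suc k)" "1 \<le> k"
  shows "prefix (Zw (Suc k)) (Zw (Suc (Suc k)))"
proof -
  have "prefix (Mw k) (Mw (Suc k))" using prefix_Mw assms(2) by simp
  then show ?thesis unfolding Zw_def Ww_good[OF assms(1)]
    by (cases "a (Suc (Suc k)) - b (Suc (Suc k)) - 1") (auto intro: prefix_order.order_trans)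
qed

lemma prefix_Zw_not_good:
  assumes "\<not> good (Suc (Suc k))" "1 \<le> k"
  shows "prefix (Zw (Suc k)) (Zw (Suc (Suc (Suc k))))"
  using prefix_Mw[of k "Suc (Suc k)"] assms(2) not_goodD(5)[OF assms(1)] by (simp add: Zw_def)

text \<open>The induction goes back by one index, or by two if the preceding index is not
  good.\<close>

lemma prefix_Zw:
  "2 \<le> i \<Longrightarrow> i \<le> j \<Longrightarrow> good i \<Longrightarrow> good j \<Longrightarrow> prefix (Zw i) (Zw j)"
proof (induction j rule: less_induct)
  case (less j)
  show ?case
  proof (cases "i = j")
    case False
    then have "i < j" using less.prems by simp
    then have "2 \<le> j" using less.prems by simp
    then obtain j' where "j = 2 + j'" using le_Suc_ex by blast
    then have j': "j = Suc (Suc j')" by simp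
    show ?thesis
    proof (cases "good (Suc j')")
      case True
      then have "prefix (Zw i) (Zw (Suc j'))" using less j' \<open>i < j\<close> by auto
      moreover have "prefix (Zw (Suc j')) (Zw j)" using prefix_Zw_good[OF True] j' \<open>i < j\<close> less.prems by auto
      ultimately show ?thesis by (rule prefix_order.order_trans)
    next
      case bad: False
      have "i \<noteq> Suc j'" using bad less.prems by auto
      then have "i \<le> j'" using \<open>i < j\<close> j' by auto
      then have "prefix (Zw i) (Zw j')" using less j' not_goodD(3)[OF bad] by auto
      moreover have "prefix (Zw j') (Zw j)"
      proof -
        obtain l where l: "j' = Suc l" "1 \<le> l" using \<open>i \<le> j'\<close> less.prems(1) by (cases j') auto
        show ?thesis using prefix_Zw_not_good[of l] bad l j' by auto
      qed
      ultimately show ?thesis by (rule prefix_order.order_trans)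
    qed
  qed simp
qed

text \<open>One of \<open>n + 3\<close> and \<open>n + 4\<close> is good, and \<open>Zw\<close> of it has more than \<open>n\<close> letters.\<close>

definition lw :: "nat \<Rightarrow> nat" where
  "lw n = (let k = (if good (n + 3) then n + 3 else n + 4) in Zw k ! (n - 1))"

lemma lw_nth:
  assumes "2 \<le> k" "good k" "i < length (Zw k)"
  shows "lw (Suc i) = Zw k ! i"
proof -
  define m where "m = (if good (i + 4) then i + 4 else i + 5)"
  have m: "good m"
  proof (cases "good (i + 4)")
    case False
    then have "\<not> good (Suc (i + 3))" by (simp add: numeral_eq_Suc)
    then have "good (Suc (Suc (i + 3)))" by (rule not_goodD(4))
    then have "good (i + 5)" by (simp add: numeral_eq_Suc)
    then show ?thesis using False by (simp add: m_def)
  qed (simp add: m_def)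
  have len: "i < length (Zw m)" using length_Zw[of m] unfolding m_def by (auto split: if_splits)
  have "prefix (Zw k) (Zw m) \<or> prefix (Zw m) (Zw k)"
  proof -
    have "2 \<le> m" by (simp add: m_def)
    then show ?thesis using prefix_Zw[of k m] prefix_Zw[of m k] assms m by (cases "k \<le> m") auto
  qed
  then have "Zw m ! i = Zw k ! i" using len assms(3) by (auto simp: prefix_def nth_append)
  moreover have "lw (Suc i) = Zw m ! i" by (simp add: lw_def m_def Let_def numeral_eq_Suc)
  ultimately show ?thesis by simp
qed

lemma good_frequently: "\<exists>k\<ge>m. good k"
proof (cases "good m")
  case False
  then obtain l where "m = Suc l" using b1 by (cases m) (auto simp: good_def)
  then show ?thesis using False not_goodD(4)[of l] by (intro exI[of _ "Suc m"]) auto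
qed auto

lemma lw_binary: "lw (Suc i) \<le> 1"
proof -
  obtain k where k: "k \<ge> i + 2" "good k" using good_frequently by blast
  then have "i < length (Zw k)" using length_Zw[of k] by simp
  then show ?thesis using lw_nth[of k i] k binary_Zw[of k] unfolding binary_def by auto
qed

lemma sum_lw:
  assumes "2 \<le> k" "good k" "n \<le> length (Zw k)"
  shows "(\<Sum>h=1..n. lw h) = sum_list (take n (Zw k))"
proof -
  have "take n (Zw k) = map (\<lambda>i. lw (Suc i)) [0..<n]"
    using assms lw_nth by (intro nth_equalityI) auto
  then show ?thesis by (simp add: interv_sum_list_conv_sum_set_nat sum.atLeast1_atMost_eq atLeast0LessThan)
qed

lemma prefix_Mw_Mw:
  assumes "1 \<le> k"
  shows "prefix (Mw (Suc k) @ Mw k) (Mw (Suc (Suc k)))"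
proof -
  obtain c where c: "a (Suc (Suc k)) = Suc c" using a_pos[of "Suc (Suc k)"] by (cases "a (Suc (Suc k))") auto
  have "prefix (Mw k) (Mw (Suc k))" using assms prefix_Mw by simp
  then show ?thesis by (cases c) (auto simp: c intro: prefix_order.order_trans)
qed

text \<open>\<open>Xw k @ Zw k\<close> equals \<open>Mw k @ Mw (k - 1)\<close>, a prefix of
  \<open>Mw (Suc k)\<close>. So \<open>lw\<close> begins like the characteristic word after deletion
  of its first \<open>length (Xw k)\<close> letters, and the deleted part contributes
  \<open>offset k\<close> to the deviation.\<close>

lemma sum_lw_offset:
  assumes "good k" "n + 4 \<le> k"
  shows "n * \<theta> + \<theta> + offset k - (\<Sum>h=1..n. lw h) \<in> {0..1}"
proof -
  obtain j where "k = 2 + j" using assms(2) le_Suc_ex[of 2 k] by auto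
  then have j: "k = Suc (Suc j)" by simp
  have "n < length (Zw k)" using length_Zw[of k] assms(2) by simp
  then have s: "(\<Sum>h=1..n. lw h) = sum_list (take n (Zw k))" using assms by (intro sum_lw) auto
  have XZ: "prefix (Xw k @ Zw k) (Mw (Suc k))"
    using prefix_Mw_Mw[of "Suc j"] unfolding Zw_def j Mw_split[of "Suc (Suc j)"] by simp
  have t: "take (length (Xw k) + n) (Mw (Suc k)) = Xw k @ take n (Zw k)"
    using XZ \<open>n < length (Zw k)\<close> by (auto simp: prefix_def)
  have "n + 2 \<le> q (Suc j)" using q_ge[of "Suc j"] assms(2) j by simp
  moreover have "length (Xw k) \<le> q (Suc (Suc j))" using length_Xw_Ww[of k] j by simp
  moreover have "q (Suc (Suc j)) + q (Suc j) \<le> q (Suc k)" using q_add_le[of "Suc j"] j by simp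
  ultimately have "Suc (length (Xw k) + n) < q (Suc k)" by simp
  from sum_take_Mw_unit[OF this] show ?thesis unfolding t s offset_eq
    by (simp add: algebra_simps)
qed

text \<open>Let \<open>k\<close> tend to infinity through the good indices; \<open>offset k\<close>
  tends to \<open>\<rho> - \<theta>\<close>. Only non-strict inequalities survive the limit, so the
  sum is left open when \<open>n * \<theta> + \<rho>\<close> is an integer.\<close>

lemma sum_lw_bounds:
  "real (\<Sum>h=1..n. lw h) \<le> n * \<theta> + \<rho>" "n * \<theta> + \<rho> \<le> real (\<Sum>h=1..n. lw h) + 1"
proof -
  define S where "S = real (\<Sum>h=1..n. lw h)"
  have lim: "(\<lambda>k. n * \<theta> + \<theta> + offset k - S) \<longlonglongrightarrow> n * \<theta> + \<rho> - S"
    using tendsto_add[OF tendsto_const offset_tendsto, of "n * \<theta> + \<theta> - S"] by (simp add: algebra_simps)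
  have fr: "\<exists>k\<ge>m. n * \<theta> + \<theta> + offset k - S \<in> {0..1}" for m
  proof -
    obtain k where "max m (n + 4) \<le> k" "good k" using good_frequently by blast
    then show ?thesis using sum_lw_offset[of k n] unfolding S_def by (intro exI[of _ k]) simp
  qed
  have "0 \<le> n * \<theta> + \<rho> - S"
  proof (rule ccontr)
    assume "\<not> ?thesis"
    then have "\<forall>\<^sub>F k in sequentially. n * \<theta> + \<theta> + offset k - S < 0" by (intro order_tendstoD(2)[OF lim]) simp
    then show False using fr unfolding eventually_sequentially by force
  qed
  moreover have "n * \<theta> + \<rho> - S \<le> 1"
  proof (rule ccontr)
    assume "\<not> ?thesis"
    then have "\<forall>\<^sub>F k in sequentially. 1 < n * \<theta> + \<theta> + offset k - S" by (intro order_tendstoD(1)[OF lim]) simp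
    then show False using fr unfolding eventually_sequentially by force
  qed
  ultimately show "real (\<Sum>h=1..n. lw h) \<le> n * \<theta> + \<rho>" "n * \<theta> + \<rho> \<le> real (\<Sum>h=1..n. lw h) + 1"
    unfolding S_def by auto
qed

section \<open>Periodic approximations\<close>

abbreviation \<xi> :: real where "\<xi> \<equiv> value_of lw"

definition tail_value :: "nat \<Rightarrow> real" where
  "tail_value k = value_of (\<lambda>n. lw (n + length (Ww k)))"

lemma value_Ww:
  assumes "2 \<le> k" "good k"
  shows "\<xi> = act (Ww k) (tail_value k)"
  unfolding tail_value_def
proof (rule value_prefix)
  fix i assume "i < length (Ww k)"
  then show "lw (Suc i) = Ww k ! i" using lw_nth[OF assms, of i] by (simp add: Zw_def nth_append)
qed (rule lw_binary)

lemma tail_value_cyl_pred: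
  assumes "2 \<le> k" "good k"
  shows "tail_value k \<in> cyl (Mw (k - 1))"
proof -
  define w where "w = (\<lambda>n. lw (n + length (Ww k)))"
  have w: "w (Suc n) \<le> 1" for n using lw_binary[of "n + length (Ww k)"] by (simp add: w_def)
  have "value_of w = act (Mw (k - 1)) (value_of (\<lambda>n. w (n + length (Mw (k - 1)))))"
  proof (rule value_prefix)
    fix i assume "i < length (Mw (k - 1))"
    then show "w (Suc i) = Mw (k - 1) ! i" using lw_nth[OF assms, of "i + length (Ww k)"]
      by (simp add: Zw_def nth_append w_def)
  qed (rule w)
  moreover have "value_of (\<lambda>n. w (n + length (Mw (k - 1)))) \<in> {0..1}"
    by (rule value_unit) (use w[of "_ + length (Mw (k - 1))"] in simp)
  ultimately show ?thesis unfolding tail_value_def w_def[symmetric] by (simp add: cyl_def)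
qed

section \<open>How the tail behind \<open>Ww k\<close> begins\<close>

definition rep :: "nat \<Rightarrow> nat" where
  "rep k = a (Suc k) - b (Suc k) - 1"

definition Vw :: "nat \<Rightarrow> nat list" where
  "Vw k = pw (rep k) (Mw k) @ Mw (k - 1)"

lemma binary_Vw [simp]: "binary (Vw k)"
  by (simp add: Vw_def)

lemma Mw_rec: "1 \<le> k \<Longrightarrow> Mw (Suc k) = pw (a (Suc k)) (Mw k) @ Mw (k - 1)"
  by (cases k) auto

lemma Ww_rec: "1 \<le> k \<Longrightarrow> good k \<Longrightarrow> Ww (Suc k) = Ww k @ Vw k"
  using Ww_good[of "k - 1"] by (cases k) (auto simp: Vw_def rep_def)

lemma tail_value_step:
  assumes "2 \<le> k" "good k" "good (Suc k)"
  shows "tail_value k = act (Vw k) (tail_value (Suc k))"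
proof -
  have "act (Ww k) (tail_value k) = act (Ww k) (act (Vw k) (tail_value (Suc k)))"
    using value_Ww[of k] value_Ww[of "Suc k"] Ww_rec[of k] assms by simp
  then show ?thesis unfolding act_inject .
qed

lemma tail_value_skip: "\<not> good (Suc k) \<Longrightarrow> tail_value (Suc (Suc k)) = tail_value k"
  using not_goodD(5)[of k] by (simp add: tail_value_def)

abbreviation rwt :: "nat list \<Rightarrow> real" where "rwt L \<equiv> real_of_int (wt L)"

text \<open>This serves as the common continuation in \<open>cyl_diff_lower\<close>: a fixed word,
  so that its weight is a constant, a prefix of all later standard words, and one that ends in 0
  because its index is even.\<close>

abbreviation Z0 :: "nat list" where "Z0 \<equiv> Mw 2"

lemma zero_in_Z0: "0 \<in> set Z0"
  using last_Mw[of 2] by auto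

lemma prefix_Z0: "2 \<le> k \<Longrightarrow> prefix Z0 (Mw k)"
  by (rule prefix_Mw) auto

lemma prefix_append_right: "prefix L R \<Longrightarrow> prefix L (R @ S)"
  by (auto simp: prefix_def)

lemma prefix_Mw_Z0: "3 \<le> k \<Longrightarrow> prefix (Mw k @ Z0) (Mw (Suc k))"
proof -
  assume k: "3 \<le> k"
  obtain c where c: "a (Suc k) = Suc c" using a_pos[of "Suc k"] by (cases "a (Suc k)") auto
  show ?thesis unfolding Mw_rec[OF order_trans[OF _ k], simplified] c
    using prefix_Z0[of k] prefix_Z0[of "k - 1"] k
    by (cases c) (auto intro: prefix_append_right)
qed

text \<open>Behind \<open>Suc e\<close> copies of \<open>Mw k\<close> comes either another copy,
  which itself begins with \<open>Mw (k - 1) @ Z0\<close>, or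
  \<open>Mw (k - 1) @ Mw k\<close>.\<close>

lemma prefix_pw:
  assumes "4 \<le> k" "e < n"
  shows "prefix (pw e (Mw k) @ Mw k @ Mw (k - 1) @ Z0) (pw n (Mw k) @ Mw (k - 1) @ Mw k)"
proof -
  have n: "pw n (Mw k) = pw e (Mw k) @ Mw k @ pw (n - e - 1) (Mw k)"
    using assms(2) pw_add[of e "Suc (n - e - 1)" "Mw k"] by simp
  have "prefix (Mw (k - 1) @ Z0) (Mw k)" using prefix_Mw_Z0[of "k - 1"] assms(1) by simp
  then show ?thesis unfolding n using prefix_Z0[of k] assms(1)
    by (cases "n - e - 1") (auto intro: prefix_append_right)
qed

lemma Mw_Mw_pred: "1 \<le> k \<Longrightarrow> Mw (Suc k) @ Mw k = pw (a (Suc k)) (Mw k) @ Mw (k - 1) @ Mw k"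
  by (simp add: Mw_rec)

lemma prefix_Mw_Mw_Z0: "4 \<le> k \<Longrightarrow> prefix (Mw k @ Mw (k - 1) @ Z0) (Mw (Suc k) @ Mw k)"
  using prefix_pw[of k 0 "a (Suc k)"] a_pos[of "Suc k"] by (simp add: Mw_Mw_pred)

lemma prefix_Mw_Mw': "2 \<le> k \<Longrightarrow> prefix (Mw k @ Mw (k - 1)) (Mw (Suc k))"
  using prefix_Mw_Mw[of "k - 1"] by simp

text \<open>The beginning \<open>Mw (k - 1)\<close> known at the next good index is pulled back:
  through \<open>Vw k\<close> if \<open>Suc k\<close> is good, and unchanged from
  \<open>Suc (Suc k)\<close> otherwise.\<close>

lemma tail_value_cyl_pred2:
  assumes "5 \<le> k" "good k"
  shows "tail_value k \<in> cyl (Mw (k - 1) @ Mw (k - 2) @ Z0)"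
proof -
  have P: "prefix (Mw (k - 1) @ Mw (k - 2) @ Z0) (Mw k @ Mw (k - 1))"
    using prefix_Mw_Mw_Z0[of "k - 1"] assms(1) by (simp add: numeral_2_eq_2)
  show ?thesis
  proof (cases "good (Suc k)")
    case True
    have "tail_value (Suc k) \<in> cyl (Mw k)" using tail_value_cyl_pred[of "Suc k"] True assms by simp
    then have "tail_value k \<in> cyl (Vw k @ Mw k)"
      unfolding cyl_append using tail_value_step[of k] True assms by simp
    moreover have "prefix (Mw (k - 1) @ Mw (k - 2) @ Z0) (Vw k @ Mw k)"
    proof (cases "rep k")
      case 0
      have "prefix (Mw (k - 2) @ Z0) (Mw (k - 1))" using prefix_Mw_Z0[of "k - 2"] assms(1)
        by (simp add: numeral_2_eq_2 Suc_diff_Suc)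
      moreover have "prefix (Mw (k - 1)) (Mw k)" using prefix_Mw assms(1) by simp
      ultimately have "prefix (Mw (k - 2) @ Z0) (Mw k)" by (rule prefix_order.order_trans)
      then show ?thesis using 0 by (simp add: Vw_def)
    next
      case (Suc c)
      have "prefix (Mw (k - 1)) (Mw k)" using prefix_Mw assms(1) by simp
      then have "prefix (Mw k @ Mw (k - 1)) (Vw k @ Mw k)"
        unfolding Vw_def Suc by (cases c) (auto intro: prefix_append_right)
      then show ?thesis using P by (rule prefix_order.order_trans[rotated])
    qed
    ultimately show ?thesis using cyl_prefix by (metis binary_Mw binary_Vw binary_simps(3) subsetD)
  next
    case False
    have "tail_value k \<in> cyl (Mw (Suc k))"
      using tail_value_cyl_pred[of "Suc (Suc k)"] not_goodD(4)[OF False] tail_value_skip[OF False] by simp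
    moreover have "prefix (Mw (k - 1) @ Mw (k - 2) @ Z0) (Mw (Suc k))"
      using P prefix_Mw_Mw'[of k] assms(1) prefix_order.order_trans by fastforce
    ultimately show ?thesis using cyl_prefix by (metis binary_Mw subsetD)
  qed
qed

text \<open>
  This decides which of \<open>Mw k @ Mw (k - 1)\<close> and \<open>Mw (k - 1) @ Mw k\<close> follows \<open>Ww k\<close>.
\<close>

definition full :: "nat \<Rightarrow> bool" where
  "full k \<longleftrightarrow> 1 \<le> rep k \<or> \<not> good (Suc k)"

lemma tail_value_full:
  assumes "5 \<le> k" "good k" "full k"
  shows "tail_value k \<in> cyl (Mw k @ Mw (k - 1) @ Z0)"
proof (cases "good (Suc k)")
  case False
  have "tail_value k \<in> cyl (Mw (Suc k) @ Mw k @ Z0)"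
    using tail_value_cyl_pred2[of "Suc (Suc k)"] not_goodD(4)[OF False] tail_value_skip[OF False] assms(1) by simp
  moreover have "prefix (Mw k @ Mw (k - 1) @ Z0) (Mw (Suc k) @ Mw k @ Z0)"
    using prefix_append_right[OF prefix_Mw_Mw_Z0[of k], of Z0] assms(1) by simp
  ultimately show ?thesis using cyl_prefix by (metis binary_Mw binary_simps(3) subsetD)
next
  case True
  then obtain c where c: "rep k = Suc c" using assms(3) by (cases "rep k") (auto simp: full_def)
  have "tail_value (Suc k) \<in> cyl (Mw k)" using tail_value_cyl_pred[of "Suc k"] True assms by simp
  then have "tail_value k \<in> cyl (Vw k @ Mw k)"
    unfolding cyl_append using tail_value_step[of k] True assms by simp
  moreover have "prefix (Mw k @ Mw (k - 1) @ Z0) (Vw k @ Mw k)"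
    using prefix_pw[of k 0 "rep k"] assms(1) c by (simp add: Vw_def)
  ultimately show ?thesis using cyl_prefix by (metis binary_Mw binary_Vw binary_simps(3) subsetD)
qed

lemma tail_value_not_full:
  assumes "5 \<le> k" "good k" "\<not> full k"
  shows "tail_value k \<in> cyl (Mw (k - 1) @ Mw k @ Mw (k - 1) @ Z0)"
proof -
  have g: "good (Suc k)" and r: "rep k = 0" using assms(3) by (auto simp: full_def)
  have "tail_value (Suc k) \<in> cyl (Mw k @ Mw (k - 1) @ Z0)"
    using tail_value_cyl_pred2[of "Suc k"] g assms(1) by simp
  then show ?thesis unfolding cyl_append[of "Mw (k - 1)"]
    using tail_value_step[of k] g r assms by (simp add: Vw_def)
qed

text \<open>The tail begins with \<open>n\<close> copies of \<open>Mw k\<close> followed by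
  \<open>Mw (k - 1) @ Mw k\<close>. Here \<open>n\<close> is \<open>a (Suc k)\<close> if the tail
  starts with \<open>Mw (Suc k) @ Mw k\<close>, and one more if it starts with
  \<open>Mw k @ Mw (Suc k) @ Mw k\<close>.\<close>

lemma tail_value_pw:
  assumes "5 \<le> k" "good (Suc k)" "e < a (Suc k) \<or> (e = a (Suc k) \<and> \<not> full (Suc k))"
  obtains z where "z \<in> cyl (Mw k @ Mw (k - 1) @ Z0)" "tail_value (Suc k) = act (pw e (Mw k)) z"
proof -
  have ex: "\<exists>n>e. tail_value (Suc k) \<in> cyl (pw n (Mw k) @ Mw (k - 1) @ Mw k @ Z0)"
  proof (cases "full (Suc k)")
    case True
    then have "tail_value (Suc k) \<in> cyl (pw (a (Suc k)) (Mw k) @ Mw (k - 1) @ Mw k @ Z0)"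
      using tail_value_full[of "Suc k"] assms by (simp add: Mw_rec)
    then show ?thesis using assms(3) True by blast
  next
    case False
    then have "tail_value (Suc k) \<in> cyl (pw (Suc (a (Suc k))) (Mw k) @ Mw (k - 1) @ Mw k @ Z0)"
      using tail_value_not_full[of "Suc k"] assms by (simp add: Mw_rec)
    then show ?thesis using assms(3) by (intro exI[of _ "Suc (a (Suc k))"]) auto
  qed
  then obtain n where n: "e < n" "tail_value (Suc k) \<in> cyl (pw n (Mw k) @ Mw (k - 1) @ Mw k @ Z0)" by blast
  have "prefix (pw e (Mw k) @ Mw k @ Mw (k - 1) @ Z0) (pw n (Mw k) @ Mw (k - 1) @ Mw k @ Z0)"
    using prefix_append_right[OF prefix_pw[of k e n], of Z0] n assms(1) by simp
  from cyl_prefixE[OF n(2) this] that show thesis by auto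
qed

section \<open>Exact distances between tails that begin with swapped factors\<close>

lemma nm_replicate_0 [simp]: "nm (replicate n 0) = 0"
  by (induction n) auto

text \<open>Removing the common prefix of copies of \<open>Mw (Suc k)\<close> exchanges the two
  words and lowers the index. At the bottom the words end in \<open>10\<close> and
  \<open>01\<close>, with numerators \<open>B\<close> and 1.\<close>

lemma nm_Mw_swap: "\<bar>nm (Mw (Suc k) @ Mw k) - nm (Mw k @ Mw (Suc k))\<bar> = B - 1"
proof (induction k)
  case 0 then show ?case using B by (simp add: nm_append)
next
  case (Suc k)
  let ?L = "pw (a (Suc (Suc k))) (Mw (Suc k))"
  have "Mw (Suc (Suc k)) @ Mw (Suc k) = ?L @ (Mw k @ Mw (Suc k))" by simp
  moreover have "Mw (Suc k) @ Mw (Suc (Suc k)) = ?L @ (Mw (Suc k) @ Mw k)"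
    using pw_commute[of "Mw (Suc k)"] by (metis Mw.simps(3) append.assoc)
  ultimately have "nm (Mw (Suc (Suc k)) @ Mw (Suc k)) - nm (Mw (Suc k) @ Mw (Suc (Suc k)))
      = nm (Mw k @ Mw (Suc k)) - nm (Mw (Suc k) @ Mw k)"
    by (simp only: nm_append[of ?L]) (simp add: mult.commute)
  then show ?case using Suc by linarith
qed

text \<open>One constant, independent of \<open>k\<close>, for the factor \<open>B\<close> in the
  upper bound and the factor \<open>wt Z0\<close> in the lower bound on distances.\<close>

definition D :: real where "D = B + wt Z0"

lemma D_ge: "1 \<le> D" "B \<le> D" "wt Z0 \<le> D"
proof -
  have "2 \<le> real_of_int B" using B by linarith
  moreover have "0 < real_of_int (wt Z0)" by (simp only: of_int_0_less_iff wt_pos)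
  ultimately show "1 \<le> D" "B \<le> D" "wt Z0 \<le> D" unfolding D_def by linarith+
qed

definition near :: "real \<Rightarrow> real \<Rightarrow> real \<Rightarrow> bool" where
  "near y z w \<longleftrightarrow> \<bar>y - z\<bar> \<le> D / w"

definition exact :: "real \<Rightarrow> real \<Rightarrow> real \<Rightarrow> bool" where
  "exact y z w \<longleftrightarrow> near y z w \<and> 1 / (D * w) \<le> \<bar>y - z\<bar>"

lemma exact_imp_near: "exact y z w \<Longrightarrow> near y z w"
  by (simp add: exact_def)

lemma exact_commute: "exact y z w \<Longrightarrow> exact z y w"
  by (simp add: exact_def near_def abs_minus_commute)

lemma near_mono: "near y z w \<Longrightarrow> 0 < w' \<Longrightarrow> w' \<le> w \<Longrightarrow> near y z w'"
  unfolding near_def using D_ge(1) by (smt (verit) divide_left_mono mult_pos_pos)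

lemma near_act:
  fixes w :: real
  shows "near y z w \<Longrightarrow> near (act L y) (act L z) (wt L * w)"
proof -
  assume "near y z w"
  moreover have "0 < real_of_int (wt L)" by simp
  moreover have "\<bar>act L y - act L z\<bar> = \<bar>y - z\<bar> / wt L" unfolding act_diff by (simp add: abs_divide abs_of_pos)
  ultimately have "\<bar>act L y - act L z\<bar> \<le> D / w / wt L" unfolding near_def by (metis divide_right_mono less_imp_le)
  then show ?thesis unfolding near_def by (simp add: mult.commute)
qed

lemma exact_act:
  fixes w :: real
  shows "exact y z w \<Longrightarrow> exact (act L y) (act L z) (wt L * w)"
proof -
  assume e: "exact y z w"
  moreover have "0 < real_of_int (wt L)" by simp
  moreover have "\<bar>act L y - act L z\<bar> = \<bar>y - z\<bar> / wt L" unfolding act_diff by (simp add: abs_divide abs_of_pos)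
  moreover have "1 / (D * (wt L * w)) = 1 / (D * w) / wt L" by simp
  ultimately show ?thesis unfolding exact_def using near_act[OF exact_imp_near[OF e]]
    by (metis divide_right_mono less_imp_le)
qed

lemma approximable_near:
  fixes u v :: real
  assumes "V \<noteq> []" "\<xi> = act U y" "near y (act V y) (wt V * v)" "u = real_of_int (wt U) * real_of_int (wt V)" "0 < v"
  shows "approximable \<xi> D u v"
proof -
  have V: "0 < real_of_int (wt V)" by simp
  have u: "0 < u" unfolding assms(4) by simp
  have "wt V * \<bar>y - act V y\<bar> \<le> wt V * (D / (wt V * v))"
    using assms(3) V unfolding near_def by (intro mult_left_mono) auto
  then have "wt V * \<bar>y - act V y\<bar> \<le> D / v" using V by simp
  moreover have "real_of_int (wt U * wt V) \<le> D * u" using D_ge(1) u unfolding assms(4) by simp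
  ultimately show ?thesis using approximable_periodic(1)[OF assms(1,2)] by simp
qed

lemma sharply_approximable_exact:
  fixes u v :: real
  assumes "V \<noteq> []" "\<xi> = act U y" "exact y (act V y) (wt V * v)" "u = real_of_int (wt U) * real_of_int (wt V)" "0 < v"
  shows "sharply_approximable \<xi> D u v"
proof -
  have V: "0 < real_of_int (wt V)" by simp
  have u: "0 < u" unfolding assms(4) by simp
  have "wt V * \<bar>y - act V y\<bar> \<le> wt V * (D / (wt V * v))"
    using assms(3) V unfolding exact_def near_def by (intro mult_left_mono) auto
  then have "wt V * \<bar>y - act V y\<bar> \<le> D / v" using V by simp
  moreover have "real_of_int (wt U * wt V) \<le> D * u" using D_ge(1) u unfolding assms(4) by simp
  moreover have "1 / (D * v) \<le> wt V * \<bar>y - act V y\<bar>"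
  proof -
    have "1 / (D * v) = wt V * (1 / (D * (wt V * v)))" using V by simp
    also have "\<dots> \<le> wt V * \<bar>y - act V y\<bar>" using assms(3) V unfolding exact_def by (intro mult_left_mono) auto
    finally show ?thesis .
  qed
  ultimately show ?thesis using approximable_periodic(2)[OF assms(1,2)] by simp
qed

lemma exact_swap:
  assumes "1 \<le> k" "y \<in> cyl (Mw k @ Mw (k - 1) @ Z0)" "z \<in> cyl (Mw (k - 1) @ Mw k @ Z0)"
  shows "exact y z (wt (Mw k) * wt (Mw (k - 1)))"
proof -
  have sw: "\<bar>nm (Mw k @ Mw (k - 1)) - nm (Mw (k - 1) @ Mw k)\<bar> = B - 1"
    using nm_Mw_swap[of "k - 1"] assms(1) by simp
  have wtc: "wt (Mw (k - 1) @ Mw k) = wt (Mw k @ Mw (k - 1))" by simp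
  have yz: "y \<in> cyl ((Mw k @ Mw (k - 1)) @ Z0)" "z \<in> cyl ((Mw (k - 1) @ Mw k) @ Z0)" using assms by simp_all
  define w where "w = real_of_int (wt (Mw k @ Mw (k - 1)))"
  have w: "0 < w" unfolding w_def by (simp only: of_int_0_less_iff wt_pos)
  have "\<bar>y - z\<bar> \<le> B / w" unfolding w_def by (rule cyl_diff_upper[OF binary_Mw yz wtc sw])
  also have "\<dots> \<le> D / w" using D_ge w by (intro divide_right_mono) auto
  finally have "near y z w" unfolding near_def .
  moreover have "1 / (D * w) \<le> \<bar>y - z\<bar>"
  proof -
    have "1 / (D * w) \<le> 1 / (wt Z0 * w)" using D_ge w by (intro divide_left_mono mult_right_mono mult_pos_pos) (auto simp del: Mw.simps)
    also have "\<dots> = 1 / wt Z0 / w" by simp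
    also have "\<dots> \<le> \<bar>y - z\<bar>" unfolding w_def by (rule cyl_diff_lower[OF binary_Mw yz wtc sw zero_in_Z0])
    finally show ?thesis .
  qed
  ultimately show ?thesis unfolding exact_def w_def by simp
qed

text \<open>Prepending one more \<open>Mw k\<close> leaves the \<open>e\<close> copies in front
  unchanged. Behind them \<open>Mw (k - 1) @ Mw k\<close> meets \<open>Mw k @ Mw (k - 1)\<close>,
  and there the period \<open>Mw k\<close> breaks.\<close>

lemma exact_shift:
  assumes "3 \<le> k" "z \<in> cyl (Mw (k - 1) @ Mw k @ Z0)" "y = act (pw e (Mw k)) z"
  shows "exact y (act (Mw k) y) (rwt (pw e (Mw k)) * (rwt (Mw k) * rwt (Mw (k - 1))))"
proof -
  have "act (Mw k) z \<in> cyl (Mw k @ Mw (k - 1) @ Mw k @ Z0)"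
    using assms(2) unfolding cyl_append[of "Mw k"] by blast
  moreover have "prefix (Mw k @ Mw (k - 1) @ Z0) (Mw k @ Mw (k - 1) @ Mw k @ Z0)"
    using prefix_Z0[of k] assms(1) by (auto intro: prefix_append_right)
  ultimately have "act (Mw k) z \<in> cyl (Mw k @ Mw (k - 1) @ Z0)"
    using cyl_prefix by (metis binary_Mw binary_simps(3) subsetD)
  then have "exact z (act (Mw k) z) (rwt (Mw k) * rwt (Mw (k - 1)))"
    using exact_swap[of k "act (Mw k) z" z] assms(1,2) by (auto intro: exact_commute)
  from exact_act[OF this, of "pw e (Mw k)"]
  show ?thesis using pw_commute[of "Mw k" e] act_append by (metis assms(3) of_int_mult)
qed

section \<open>The families of periodic approximations\<close>

lemma Mw_nonempty [simp]: "Mw k \<noteq> []"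
  using last_Mw[of k] by auto

lemma Ww_Xw_nonempty: "Ww k @ Xw k \<noteq> []"
proof
  assume "Ww k @ Xw k = []"
  then have "q k = 0" using length_Xw_Ww[of k] by simp
  then show False using q_pos[of k] by linarith
qed

lemma wt_Mw_split: "rwt (Mw k) = rwt (Xw k) * rwt (Ww k)"
  using arg_cong[OF Mw_split[of k], of wt] by simp

lemma wt_Ww_rec: "1 \<le> k \<Longrightarrow> good k \<Longrightarrow> rwt (Ww (Suc k)) = rwt (Ww k) * rwt (pw (rep k) (Mw k)) * rwt (Mw (k - 1))"
  by (simp add: Ww_rec Vw_def)

lemma wt_Mw_rec: "1 \<le> k \<Longrightarrow> rwt (Mw (Suc k)) = rwt (pw (a (Suc k)) (Mw k)) * rwt (Mw (k - 1))"
  by (simp add: Mw_rec)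

lemma pred_tail_value_cyl:
  assumes "5 \<le> k" "good (Suc k)"
  shows "act (Mw (k - 1)) (tail_value (Suc k)) \<in> cyl (Mw (k - 1) @ Mw k @ Z0)"
proof -
  have "tail_value (Suc k) \<in> cyl (Mw k @ Mw (k - 1) @ Z0)"
    using tail_value_cyl_pred2[of "Suc k"] assms by simp
  moreover have "prefix (Mw k @ Z0) (Mw k @ Mw (k - 1) @ Z0)"
    using prefix_Z0[of "k - 1"] assms(1) by (auto intro: prefix_append_right)
  ultimately have "tail_value (Suc k) \<in> cyl (Mw k @ Z0)"
    using cyl_prefix by (metis binary_Mw binary_simps(3) subsetD)
  then show ?thesis unfolding cyl_append[of "Mw (k - 1)"] by blast
qed

lemma tail_value_step':
  assumes "2 \<le> k" "good k" "good (Suc k)"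
  shows "tail_value k = act (pw (rep k) (Mw k)) (act (Mw (k - 1)) (tail_value (Suc k)))"
  using tail_value_step[OF assms] by (simp add: Vw_def)

text \<open>
  The approximations belong to the four families of the theorem: those of \<open>nu4\<close> (and, if \<open>Suc k\<close> is
  not good, of \<open>nu2\<close>) have period \<open>Ww k @ Xw k\<close>, those of \<open>nu1\<close> have preperiod \<open>Ww k\<close> and period \<open>Vw k\<close>,
  those of \<open>nu2\<close> have period \<open>Ww (Suc k) @ Xw k\<close>, and those of \<open>nu3\<close> have preperiod \<open>Ww (Suc k)\<close> and
  period \<open>Mw k\<close>.
\<close>

lemma sharp_Mw:
  assumes "5 \<le> k" "good k" "good (Suc k)"
  shows "sharply_approximable \<xi> D (rwt (Mw k)) (rwt (Ww (Suc k)))"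
proof (rule sharply_approximable_exact[where U = "[]" and V = "Ww k @ Xw k" and y = \<xi>])
  have V: "rwt (Ww k @ Xw k) = rwt (Mw k)" unfolding wt_Mw_split by simp
  show "Ww k @ Xw k \<noteq> []" by (rule Ww_Xw_nonempty)
  show "rwt (Mw k) = rwt [] * rwt (Ww k @ Xw k)" unfolding V by simp
  have xi: "\<xi> = act (Ww k) (tail_value k)" using value_Ww assms by simp
  \<comment> \<open>The rotation of the period is what makes the preperiod empty: as
    \<open>Xw k @ Ww k = Mw k\<close>, the period followed by \<open>\<xi>\<close> is
    \<open>Ww k\<close> followed by \<open>Mw k\<close> and the tail behind
    \<open>Ww k\<close>.\<close>
  have V\<xi>: "act (Ww k @ Xw k) \<xi> = act (Ww k) (act (Mw k) (tail_value k))"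
    unfolding xi Mw_split[of k] by simp
  have "exact (tail_value k) (act (Mw k) (tail_value k)) (rwt (pw (rep k) (Mw k)) * (rwt (Mw k) * rwt (Mw (k - 1))))"
    using exact_shift[OF _ pred_tail_value_cyl tail_value_step'] assms by simp
  from exact_act[OF this, of "Ww k"]
  have "exact \<xi> (act (Ww k @ Xw k) \<xi>) (rwt (Ww k) * (rwt (pw (rep k) (Mw k)) * (rwt (Mw k) * rwt (Mw (k - 1)))))"
    unfolding V\<xi> xi[symmetric] .
  moreover have "rwt (Ww k) * (rwt (pw (rep k) (Mw k)) * (rwt (Mw k) * rwt (Mw (k - 1))))
      = rwt (Ww k @ Xw k) * rwt (Ww (Suc k))"
    unfolding V using wt_Ww_rec[of k] assms by simp
  ultimately show "exact \<xi> (act (Ww k @ Xw k) \<xi>) (rwt (Ww k @ Xw k) * rwt (Ww (Suc k)))"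
    by (simp only:)
qed simp_all

text \<open>The tail behind \<open>Ww k\<close> is also the tail behind
  \<open>Ww (Suc (Suc k))\<close>, hence begins with \<open>Mw (Suc k) @ Mw k\<close>. The period
  \<open>Mw k\<close> now persists for \<open>a (Suc k)\<close> copies instead of
  \<open>rep k\<close>.\<close>

lemma sharp_Mw_skip:
  assumes "5 \<le> k" "\<not> good (Suc k)"
  shows "sharply_approximable \<xi> D (rwt (Mw k)) (rwt (Ww k) * rwt (Mw (Suc k)))"
proof (rule sharply_approximable_exact[where U = "[]" and V = "Ww k @ Xw k" and y = \<xi>])
  have V: "rwt (Ww k @ Xw k) = rwt (Mw k)" unfolding wt_Mw_split by simp
  show "Ww k @ Xw k \<noteq> []" by (rule Ww_Xw_nonempty)
  show "rwt (Mw k) = rwt [] * rwt (Ww k @ Xw k)" unfolding V by simp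
  have xi: "\<xi> = act (Ww k) (tail_value k)" using value_Ww not_goodD(3)[OF assms(2)] assms(1) by simp
  have V\<xi>: "act (Ww k @ Xw k) \<xi> = act (Ww k) (act (Mw k) (tail_value k))"
    unfolding xi Mw_split[of k] by simp
  have "tail_value k \<in> cyl (Mw (Suc k) @ Mw k @ Z0)"
    using tail_value_cyl_pred2[of "Suc (Suc k)"] not_goodD(4)[OF assms(2)] tail_value_skip[OF assms(2)] assms(1) by simp
  then have "tail_value k \<in> cyl (pw (a (Suc k)) (Mw k) @ (Mw (k - 1) @ Mw k @ Z0))"
    using assms(1) by (simp add: Mw_rec)
  then obtain z where z: "z \<in> cyl (Mw (k - 1) @ Mw k @ Z0)" "tail_value k = act (pw (a (Suc k)) (Mw k)) z"
    by (rule cyl_appendE)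
  have "exact (tail_value k) (act (Mw k) (tail_value k)) (rwt (pw (a (Suc k)) (Mw k)) * (rwt (Mw k) * rwt (Mw (k - 1))))"
    using exact_shift[OF _ z] assms by simp
  from exact_act[OF this, of "Ww k"]
  have "exact \<xi> (act (Ww k @ Xw k) \<xi>) (rwt (Ww k) * (rwt (pw (a (Suc k)) (Mw k)) * (rwt (Mw k) * rwt (Mw (k - 1)))))"
    unfolding V\<xi> xi[symmetric] .
  moreover have "rwt (Ww k) * (rwt (pw (a (Suc k)) (Mw k)) * (rwt (Mw k) * rwt (Mw (k - 1))))
      = rwt (Ww k @ Xw k) * (rwt (Ww k) * rwt (Mw (Suc k)))"
    unfolding V using wt_Mw_rec[of k] assms by simp
  ultimately show "exact \<xi> (act (Ww k @ Xw k) \<xi>) (rwt (Ww k @ Xw k) * (rwt (Ww k) * rwt (Mw (Suc k))))"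
    by (simp only:)
qed simp_all

text \<open>Removing \<open>Vw k\<close> reduces the comparison to \<open>tail_value (Suc k)\<close>
  against \<open>tail_value k\<close>. Both begin with \<open>rep k\<close> copies of
  \<open>Mw k\<close>, followed by \<open>Mw k @ Mw (k - 1)\<close> in the former and by
  \<open>Mw (k - 1) @ Mw k\<close> in the latter.\<close>

lemma sharp_Ww:
  assumes "5 \<le> k" "good k" "good (Suc k)"
  shows "sharply_approximable \<xi> D (rwt (Ww (Suc k))) (rwt (Ww (Suc k)) * rwt (Xw k))"
proof (rule sharply_approximable_exact[where U = "Ww k" and V = "Vw k" and y = "tail_value k"])
  show "Vw k \<noteq> []" by (simp add: Vw_def)
  show "\<xi> = act (Ww k) (tail_value k)" using value_Ww assms by simp
  show "rwt (Ww (Suc k)) = rwt (Ww k) * rwt (Vw k)" using Ww_rec[of k] assms by simp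
  have "rep k < a (Suc k)" using a_pos[of "Suc k"] by (simp add: rep_def)
  then obtain z where z: "z \<in> cyl (Mw k @ Mw (k - 1) @ Z0)" "tail_value (Suc k) = act (pw (rep k) (Mw k)) z"
    using tail_value_pw[of k "rep k"] assms by blast
  have "exact z (act (Mw (k - 1)) (tail_value (Suc k))) (rwt (Mw k) * rwt (Mw (k - 1)))"
    using exact_swap[OF _ z(1) pred_tail_value_cyl] assms by simp
  from exact_act[OF this, of "pw (rep k) (Mw k)"]
  have "exact (tail_value (Suc k)) (tail_value k) (rwt (pw (rep k) (Mw k)) * (rwt (Mw k) * rwt (Mw (k - 1))))"
    using z(2) tail_value_step'[of k] assms by simp
  from exact_act[OF this, of "Vw k"]
  have "exact (tail_value k) (act (Vw k) (tail_value k)) (rwt (Vw k) * (rwt (pw (rep k) (Mw k)) * (rwt (Mw k) * rwt (Mw (k - 1)))))"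
    using tail_value_step[of k] assms by simp
  moreover have "rwt (pw (rep k) (Mw k)) * (rwt (Mw k) * rwt (Mw (k - 1))) = rwt (Ww (Suc k)) * rwt (Xw k)"
    unfolding wt_Mw_split[of k] using wt_Ww_rec[of k] assms by simp
  ultimately show "exact (tail_value k) (act (Vw k) (tail_value k)) (rwt (Vw k) * (rwt (Ww (Suc k)) * rwt (Xw k)))"
    by (simp only:)
qed simp_all

text \<open>One period followed by \<open>\<xi>\<close> is \<open>Ww (Suc k)\<close>, then
  \<open>Suc (rep k)\<close> copies of \<open>Mw k\<close>, then \<open>Mw (k - 1)\<close> and the
  tail behind \<open>Ww (Suc k)\<close>. This is compared with that tail itself, which by
  \<open>tail_value_pw\<close> usually continues with a further \<open>Mw k\<close> at the decisive
  place.\<close>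

lemma approximable_Ww_Xw:
  assumes "5 \<le> k" "good k" "good (Suc k)"
  shows "approximable \<xi> D (rwt (Ww (Suc k)) * rwt (Xw k)) (rwt (Ww (Suc k)) * rwt (Mw k))"
    and "0 < b (Suc k) \<Longrightarrow>
      sharply_approximable \<xi> D (rwt (Ww (Suc k)) * rwt (Xw k)) (rwt (Ww (Suc k)) * rwt (Mw k))"
proof -
  let ?V = "Ww (Suc k) @ Xw k" and ?y = "tail_value (Suc k)"
  define e where "e = Suc (rep k)"
  define z where "z = act (Mw (k - 1)) ?y"
  have z: "z \<in> cyl (Mw (k - 1) @ Mw k @ Z0)" unfolding z_def using pred_tail_value_cyl assms by simp
  have Wne: "?V \<noteq> []" using Ww_rec[of k] assms by (simp add: Vw_def)
  have xi: "\<xi> = act (Ww (Suc k)) ?y" using value_Ww[of "Suc k"] assms by simp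
  have "act (Xw k) \<xi> = act (Mw k) (tail_value k)" using value_Ww[of k] assms Mw_split[of k] by simp
  also have "\<dots> = act (pw e (Mw k)) z" using tail_value_step'[of k] assms by (simp add: e_def z_def)
  finally have V\<xi>: "act ?V \<xi> = act (Ww (Suc k)) (act (pw e (Mw k)) z)" by simp
  have wt: "rwt (Ww (Suc k)) * (rwt (pw e (Mw k)) * (rwt (Mw k) * rwt (Mw (k - 1)))) = rwt ?V * (rwt (Ww (Suc k)) * rwt (Mw k))"
  proof -
    have "rwt (pw e (Mw k)) * rwt (Mw (k - 1)) = (rwt (Xw k) * rwt (Ww k)) * rwt (pw (rep k) (Mw k)) * rwt (Mw (k - 1))"
      by (simp add: e_def wt_Mw_split)
    also have "\<dots> = rwt (Xw k) * rwt (Ww (Suc k))" using wt_Ww_rec[of k] assms by (simp add: mult_ac)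
    finally have h: "rwt (pw e (Mw k)) * rwt (Mw (k - 1)) = rwt (Xw k) * rwt (Ww (Suc k))" .
    have "rwt (Ww (Suc k)) * (rwt (pw e (Mw k)) * (rwt (Mw k) * rwt (Mw (k - 1))))
        = rwt (Ww (Suc k)) * (rwt (pw e (Mw k)) * rwt (Mw (k - 1))) * rwt (Mw k)" by (simp only: mult_ac)
    then show ?thesis unfolding h wt_append of_int_mult by (simp only: mult_ac)
  qed
  have d: "rwt (Ww (Suc k)) * rwt (Xw k) = rwt [] * rwt ?V" by simp
  have ex: "exact ?y (act (pw e (Mw k)) z) (rwt (pw e (Mw k)) * (rwt (Mw k) * rwt (Mw (k - 1))))"
    if e: "e < a (Suc k) \<or> (e = a (Suc k) \<and> \<not> full (Suc k))"
  proof -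
    obtain u where u: "u \<in> cyl (Mw k @ Mw (k - 1) @ Z0)" "?y = act (pw e (Mw k)) u"
      using tail_value_pw[OF assms(1,3) e] by blast
    have "exact u z (rwt (Mw k) * rwt (Mw (k - 1)))"
      using exact_swap[OF _ u(1) z] assms by simp
    from exact_act[OF this, of "pw e (Mw k)"] show ?thesis unfolding u(2) by simp
  qed
  have e_le: "e \<le> a (Suc k)" "0 < b (Suc k) \<Longrightarrow> e < a (Suc k)" using assms(2) by (auto simp: e_def rep_def good_def)
  have nr: "near ?y (act (pw e (Mw k)) z) (rwt (pw e (Mw k)) * (rwt (Mw k) * rwt (Mw (k - 1))))"
  proof (cases "e < a (Suc k) \<or> (e = a (Suc k) \<and> \<not> full (Suc k))")
    case True
    then show ?thesis using ex exact_imp_near by blast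
  next
    \<comment> \<open>This is the degenerate case \<open>b (Suc k) = 0\<close>: the two sides agree
      also on \<open>Mw (k - 1) @ Mw k\<close>, so only the upper bound remains.\<close>
    case False
    then have e: "e = a (Suc k)" "full (Suc k)" using e_le by auto
    then have "?y \<in> cyl (pw e (Mw k) @ (Mw (k - 1) @ Mw k @ Z0))"
      using tail_value_full[of "Suc k"] assms by (simp add: Mw_rec)
    then obtain u where u: "u \<in> cyl (Mw (k - 1) @ Mw k @ Z0)" "?y = act (pw e (Mw k)) u"
      by (rule cyl_appendE)
    have "near u z (rwt (Mw k) * rwt (Mw (k - 1)))"
    proof -
      let ?L = "Mw (k - 1) @ Mw k"
      have "u \<in> cyl (?L @ Z0)" "z \<in> cyl (?L @ Z0)" using u(1) z by simp_all
      then obtain u' z' where u': "u' \<in> cyl Z0" "u = act ?L u'" and z': "z' \<in> cyl Z0" "z = act ?L z'"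
        unfolding cyl_append[of ?L] by blast
      have "u' \<in> {0..1}" "z' \<in> {0..1}" using u' z' cyl_unit[of Z0] by auto
      then have "near u' z' 1" using D_ge(1) by (auto simp: near_def)
      from near_act[OF this, of ?L] show ?thesis unfolding u' z' by (simp add: mult.commute)
    qed
    from near_act[OF this, of "pw e (Mw k)"] show ?thesis unfolding u(2) by simp
  qed
  have "near \<xi> (act ?V \<xi>) (rwt ?V * (rwt (Ww (Suc k)) * rwt (Mw k)))"
    using near_act[OF nr, of "Ww (Suc k)"] unfolding wt V\<xi> xi[symmetric] .
  from approximable_near[OF Wne _ this d] show "approximable \<xi> D (rwt (Ww (Suc k)) * rwt (Xw k)) (rwt (Ww (Suc k)) * rwt (Mw k))"
    by simp
  assume "0 < b (Suc k)"
  then have "e < a (Suc k) \<or> (e = a (Suc k) \<and> \<not> full (Suc k))" using e_le by simp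
  then have "exact \<xi> (act ?V \<xi>) (rwt ?V * (rwt (Ww (Suc k)) * rwt (Mw k)))"
    using exact_act[OF ex, of "Ww (Suc k)"] unfolding wt V\<xi> xi[symmetric] by simp
  from sharply_approximable_exact[OF Wne _ this d]
  show "sharply_approximable \<xi> D (rwt (Ww (Suc k)) * rwt (Xw k)) (rwt (Ww (Suc k)) * rwt (Mw k))" by simp
qed

text \<open>The period breaks behind \<open>a (Suc k)\<close> copies of \<open>Mw k\<close> if
  \<open>Suc k\<close> is full. Otherwise there is one more copy, and the error is smaller than the
  stated order.\<close>

lemma approximable_Ww_Mw:
  assumes "5 \<le> k" "good (Suc k)"
  shows "approximable \<xi> D (rwt (Ww (Suc k)) * rwt (Mw k)) (rwt (Mw (Suc k)))"
    and "full (Suc k) \<Longrightarrow> sharply_approximable \<xi> D (rwt (Ww (Suc k)) * rwt (Mw k)) (rwt (Mw (Suc k)))"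
proof -
  let ?y = "tail_value (Suc k)"
  have xi: "\<xi> = act (Ww (Suc k)) ?y" using value_Ww[of "Suc k"] assms by simp
  have ex: "exact ?y (act (Mw k) ?y) (rwt (pw e (Mw k)) * (rwt (Mw k) * rwt (Mw (k - 1))))"
    if y: "?y \<in> cyl (pw e (Mw k) @ (Mw (k - 1) @ Mw k @ Z0))" for e
  proof -
    obtain z where "z \<in> cyl (Mw (k - 1) @ Mw k @ Z0)" "?y = act (pw e (Mw k)) z"
      using y by (rule cyl_appendE)
    then show ?thesis using exact_shift[of k z ?y e] assms by simp
  qed
  have d: "rwt (Ww (Suc k)) * rwt (Mw k) = rwt (Ww (Suc k)) * rwt (Mw k)" ..
  have fl: "exact ?y (act (Mw k) ?y) (rwt (Mw k) * rwt (Mw (Suc k)))" if "full (Suc k)"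
  proof -
    have "?y \<in> cyl (pw (a (Suc k)) (Mw k) @ (Mw (k - 1) @ Mw k @ Z0))"
      using tail_value_full[of "Suc k"] assms that by (simp add: Mw_rec)
    from ex[OF this] show ?thesis using wt_Mw_rec[of k] assms by (simp add: mult_ac)
  qed
  have "near ?y (act (Mw k) ?y) (rwt (Mw k) * rwt (Mw (Suc k)))"
  proof (cases "full (Suc k)")
    case True then show ?thesis using fl exact_imp_near by blast
  next
    case False
    then have "?y \<in> cyl (pw (Suc (a (Suc k))) (Mw k) @ (Mw (k - 1) @ Mw k @ Z0))"
      using tail_value_not_full[of "Suc k"] assms by (simp add: Mw_rec)
    from exact_imp_near[OF ex[OF this]]
    have "near ?y (act (Mw k) ?y) (rwt (Mw k) * (rwt (Mw k) * rwt (Mw (Suc k))))"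
      using wt_Mw_rec[of k] assms by (simp add: mult_ac)
    moreover have "rwt (Mw k) * rwt (Mw (Suc k)) \<le> rwt (Mw k) * (rwt (Mw k) * rwt (Mw (Suc k)))"
      using wt_ge_1[of "Mw k"] mult_right_mono[of 1 "rwt (Mw k)" "rwt (Mw k) * rwt (Mw (Suc k))"]
      by simp
    ultimately show ?thesis using near_mono[of ?y "act (Mw k) ?y"] by simp
  qed
  from approximable_near[OF Mw_nonempty xi this d]
  show "approximable \<xi> D (rwt (Ww (Suc k)) * rwt (Mw k)) (rwt (Mw (Suc k)))" by simp
  assume "full (Suc k)"
  from sharply_approximable_exact[OF Mw_nonempty xi fl[OF this] d]
  show "sharply_approximable \<xi> D (rwt (Ww (Suc k)) * rwt (Mw k)) (rwt (Mw (Suc k)))" by simp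
qed

section \<open>Covering all scales\<close>

declare cf_num.simps [simp del] cf_den.simps [simp del]
declare Mw.simps [simp del] Ww.simps [simp del] Xw.simps [simp del]

text \<open>
  The letter 1 has frequency \<open>\<theta>\<close> in the words below, with bounded discrepancy, so their weights are powers
  of \<open>base\<close> up to bounded factors.
\<close>

definition base :: real where "base = B * A powr \<theta>"

lemma A_ge_1: "1 \<le> real_of_int A" and B_ge_2: "2 \<le> real_of_int B"
  using A B by linarith+

lemma base_gt_1: "1 < base"
proof -
  have "2 * 1 \<le> base" unfolding base_def
    using A_ge_1 B_ge_2 \<theta>_pos by (intro mult_mono ge_one_powr_ge_zero) auto
  then show ?thesis by simp
qed

lemma base_pos [simp]: "0 < base"
  using base_gt_1 by simp

lemma rwt_base:
  assumes "\<bar>real (sum_list L) - \<theta> * length L\<bar> \<le> K"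
  shows "rwt L \<le> A powr K * base ^ length L" "base ^ length L \<le> A powr K * rwt L"
proof -
  define d where "d = real (sum_list L) - \<theta> * length L"
  have A0: "0 < real_of_int A" using A_ge_1 by simp
  have "real_of_int A ^ sum_list L = A powr (\<theta> * length L + d)"
    using A0 by (simp add: d_def powr_realpow)
  also have "\<dots> = (A powr \<theta>) ^ length L * A powr d"
    using A0 by (simp add: powr_add powr_powr flip: powr_realpow)
  finally have w: "rwt L = base ^ length L * A powr d"
    by (simp add: wt_eq base_def power_mult_distrib)
  have "A powr d \<le> A powr K" using assms A_ge_1 unfolding d_def by (intro powr_mono) auto
  then have "base ^ length L * A powr d \<le> base ^ length L * A powr K"
    by (intro mult_left_mono) (auto simp: less_imp_le)
  then show "rwt L \<le> A powr K * base ^ length L" unfolding w by (simp only: mult.commute)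
  have "A powr 0 \<le> A powr (K + d)" using assms A_ge_1 unfolding d_def by (intro powr_mono) auto
  then have "1 \<le> A powr K * A powr d" using A0 by (simp add: powr_add)
  then have "base ^ length L * 1 \<le> base ^ length L * (A powr K * A powr d)"
    by (intro mult_left_mono) (auto simp: less_imp_le)
  then show "base ^ length L \<le> A powr K * rwt L" unfolding w by (simp add: mult_ac)
qed

abbreviation r where "r k \<equiv> length (Ww k)"
abbreviation t where "t k \<equiv> length (Xw k)"

definition comparable :: "real \<Rightarrow> real \<Rightarrow> nat \<Rightarrow> bool" where
  "comparable F u d \<longleftrightarrow> 0 < u \<and> u \<le> F * base ^ d \<and> base ^ d \<le> F * u"

lemma comparable_mult:
  assumes "comparable F u d" "comparable F v n" "0 \<le> F"
  shows "comparable (F\<^sup>2) (u * v) (d + n)"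
proof -
  have "u * v \<le> (F * base ^ d) * (F * base ^ n)" using assms by (intro mult_mono) (auto simp: comparable_def)
  moreover have "base ^ d * base ^ n \<le> (F * u) * (F * v)"
    using assms by (intro mult_mono) (auto simp: comparable_def less_imp_le)
  ultimately show ?thesis using assms by (simp add: comparable_def power2_eq_square power_add mult_ac)
qed

lemma comparable_mono: "comparable F u d \<Longrightarrow> F \<le> G \<Longrightarrow> comparable G u d"
  unfolding comparable_def using base_pos
  by (meson less_imp_le mult_right_mono order_trans zero_less_power)

text \<open>The discrepancy of \<open>Mw k\<close> is at most 1, that of \<open>Xw k\<close> is
  bounded because \<open>offset\<close> converges, and that of \<open>Ww k\<close> is their
  difference.\<close>

lemma comparable_words:
  obtains F where "1 \<le> F" "\<And>k. comparable F (rwt (Mw k)) (q k)" "\<And>k. comparable F (rwt (Ww k)) (r k)"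
    "\<And>k. comparable F (rwt (Xw k)) (t k)"
proof -
  obtain K where K: "0 < K" "\<And>k. \<bar>offset k\<bar> \<le> K"
    using offset_tendsto by (metis convergent_def convergent_imp_Bseq BseqE real_norm_def)
  define F where "F = A powr (K + 1)"
  have cmp: "comparable F (rwt L) (length L)" if "\<bar>real (sum_list L) - \<theta> * length L\<bar> \<le> K + 1" for L
    using rwt_base[OF that] unfolding comparable_def F_def by simp
  have M: "\<bar>real (sum_list (Mw k)) - \<theta> * length (Mw k)\<bar> \<le> 1" for k
    using abs_\<delta>_le_1[of k] by (simp add: \<delta>_def mult.commute abs_minus_commute)
  have X: "\<bar>real (sum_list (Xw k)) - \<theta> * length (Xw k)\<bar> \<le> K" for k
    using K(2)[of k] by (simp add: offset_eq mult.commute abs_minus_commute)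
  have W: "\<bar>real (sum_list (Ww k)) - \<theta> * length (Ww k)\<bar> \<le> K + 1" for k
  proof -
    have "real (sum_list (Ww k)) - \<theta> * length (Ww k)
        = (real (sum_list (Mw k)) - \<theta> * length (Mw k)) - (real (sum_list (Xw k)) - \<theta> * length (Xw k))"
      unfolding Mw_split by (simp add: algebra_simps)
    then show ?thesis using M[of k] X[of k] by linarith
  qed
  show thesis
  proof
    show "1 \<le> F" unfolding F_def using A_ge_1 K(1) by (intro ge_one_powr_ge_zero) auto
    show "comparable F (rwt (Mw k)) (q k)" for k using cmp[of "Mw k"] M[of k] K(1) by simp
    show "comparable F (rwt (Ww k)) (r k)" for k using cmp[of "Ww k"] W[of k] by simp
    show "comparable F (rwt (Xw k)) (t k)" for k using cmp[of "Xw k"] X[of k] by simp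
  qed
qed

section \<open>The approximations in powers of \<open>base\<close>\<close>

definition sharp :: "real \<Rightarrow> real \<Rightarrow> nat \<Rightarrow> nat \<Rightarrow> bool" where
  "sharp \<zeta> C d n \<longleftrightarrow> sharply_approximable \<zeta> C (base ^ d) (base ^ n)"

definition appr :: "real \<Rightarrow> real \<Rightarrow> nat \<Rightarrow> nat \<Rightarrow> bool" where
  "appr \<zeta> C d n \<longleftrightarrow> approximable \<zeta> C (base ^ d) (base ^ n)"

text \<open>All that both halves of the proof need to know about the number. It is stated for an
  arbitrary \<open>\<zeta>\<close> with one constant, so that it passes from \<open>\<xi>\<close> to
  its affine images.\<close>

definition scheme :: "real \<Rightarrow> real \<Rightarrow> bool" where
  "scheme \<zeta> C \<longleftrightarrow> (\<forall>k\<ge>5.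
     (good k \<and> good (Suc k) \<longrightarrow> sharp \<zeta> C (q k) (r (Suc k))) \<and>
     (\<not> good (Suc k) \<longrightarrow> sharp \<zeta> C (q k) (r k + q (Suc k))) \<and>
     (good k \<and> good (Suc k) \<longrightarrow> sharp \<zeta> C (r (Suc k)) (r (Suc k) + t k)) \<and>
     (good k \<and> good (Suc k) \<longrightarrow> appr \<zeta> C (r (Suc k) + t k) (r (Suc k) + q k)) \<and>
     (good k \<and> good (Suc k) \<and> 0 < b (Suc k) \<longrightarrow> sharp \<zeta> C (r (Suc k) + t k) (r (Suc k) + q k)) \<and>
     (good (Suc k) \<longrightarrow> appr \<zeta> C (r (Suc k) + q k) (q (Suc k))) \<and>
     (good (Suc k) \<and> full (Suc k) \<longrightarrow> sharp \<zeta> C (r (Suc k) + q k) (q (Suc k))))"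

lemma scheme_xi: "\<exists>C\<ge>1. scheme \<xi> C"
proof -
  obtain F where F: "1 \<le> F" "\<And>k. comparable F (rwt (Mw k)) (q k)" "\<And>k. comparable F (rwt (Ww k)) (r k)"
    "\<And>k. comparable F (rwt (Xw k)) (t k)" using comparable_words by blast
  define G where "G = F\<^sup>2"
  have "1 * F \<le> F * F" using F(1) by (intro mult_right_mono) auto
  then have FG: "F \<le> G" "1 \<le> G" "0 \<le> F" using F(1) unfolding G_def power2_eq_square by linarith+
  note c1 = comparable_mono[OF F(2) FG(1)] comparable_mono[OF F(3) FG(1)] comparable_mono[OF F(4) FG(1)]
  note c2 = comparable_mult[OF F(3) F(2) FG(3), folded G_def] comparable_mult[OF F(3) F(4) FG(3), folded G_def]
  have sh: "sharp \<xi> (D * G) d n" if "sharply_approximable \<xi> D u v" "comparable G u d" "comparable G v n" for u v d n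
    unfolding sharp_def
    by (rule sharply_approximable_mono[OF that(1) D_ge(1) FG(2)]) (use that in \<open>auto simp: comparable_def\<close>)
  have ap: "appr \<xi> (D * G) d n" if "approximable \<xi> D u v" "comparable G u d" "comparable G v n" for u v d n
    unfolding appr_def
    by (rule approximable_mono[OF that(1) D_ge(1) FG(2)]) (use that in \<open>auto simp: comparable_def\<close>)
  have "scheme \<xi> (D * G)" unfolding scheme_def
  proof (intro allI impI conjI; (elim conjE)?)
    fix k :: nat assume k: "5 \<le> k"
    { assume g: "good k" "good (Suc k)"
      show "sharp \<xi> (D * G) (q k) (r (Suc k))"
        using sh[OF sharp_Mw[OF k g]] c1 by blast
      show "sharp \<xi> (D * G) (r (Suc k)) (r (Suc k) + t k)"
        using sh[OF sharp_Ww[OF k g]] c1 c2 by blast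
      show "appr \<xi> (D * G) (r (Suc k) + t k) (r (Suc k) + q k)"
        using ap[OF approximable_Ww_Xw(1)[OF k g]] c2 by blast
      assume "0 < b (Suc k)"
      then show "sharp \<xi> (D * G) (r (Suc k) + t k) (r (Suc k) + q k)"
        using sh[OF approximable_Ww_Xw(2)[OF k g]] c2 by blast }
    { assume g: "good (Suc k)"
      show "appr \<xi> (D * G) (r (Suc k) + q k) (q (Suc k))"
        using ap[OF approximable_Ww_Mw(1)[OF k g]] c1 c2 by blast
      assume "full (Suc k)"
      then show "sharp \<xi> (D * G) (r (Suc k) + q k) (q (Suc k))"
        using sh[OF approximable_Ww_Mw(2)[OF k g]] c1 c2 by blast }
    assume "\<not> good (Suc k)"
    then show "sharp \<xi> (D * G) (q k) (r k + q (Suc k))"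
      using sh[OF sharp_Mw_skip[OF k]] c1 c2 by blast
  qed
  moreover have "1 * 1 \<le> D * G" using D_ge(1) FG(2) by (intro mult_mono) auto
  ultimately show ?thesis by auto
qed

lemma scheme_affine:
  fixes g h c :: int
  assumes "scheme \<xi> C" "1 \<le> C" "0 < g" "0 < h" "\<zeta> = (g * \<xi> + c) / h"
  shows "\<exists>C\<ge>1. scheme \<zeta> C"
proof -
  have C: "0 < C" using assms(2) by simp
  have gh: "1 \<le> real_of_int (g + h)" using assms by linarith
  have sh: "sharp \<xi> C d n \<Longrightarrow> sharp \<zeta> (C * (g + h)) d n" for d n
    unfolding sharp_def using assms C by (intro sharply_approximable_affine) auto
  have ap: "appr \<xi> C d n \<Longrightarrow> appr \<zeta> (C * (g + h)) d n" for d n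
    unfolding appr_def using assms C by (intro approximable_affine) auto
  have "scheme \<zeta> (C * (g + h))" using assms(1) sh ap unfolding scheme_def by blast
  moreover have "1 * 1 \<le> C * (g + h)" using assms(2) gh by (intro mult_mono) auto
  ultimately show ?thesis by auto
qed

lemma r_t: "r k + t k = q k"
  using length_Xw_Ww[of k] by simp

lemma r_rec: "1 \<le> k \<Longrightarrow> good k \<Longrightarrow> r (Suc k) = r k + rep k * q k + q (k - 1)"
  by (simp add: Ww_rec Vw_def)

lemma t_rec: "t (Suc k) = t k + b (Suc k) * q k"
  by (simp add: length_Xw_sum)

lemma r_skip: "\<not> good (Suc k) \<Longrightarrow> r (Suc (Suc k)) = r k"
  using not_goodD(5)[of k] by simp

lemma t_skip: "\<not> good (Suc k) \<Longrightarrow> t (Suc k) = t k"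
  using not_goodD(6)[of k] by simp

text \<open>If \<open>k = Suc j\<close> is not good, then \<open>Xw k = Xw j\<close> and
  \<open>Ww (Suc k) = Ww j\<close>, and the claim becomes the approximation with exponents
  \<open>q j\<close> and \<open>r j + q (Suc j)\<close>.\<close>

lemma appr_r_t:
  assumes "scheme \<zeta> C" "6 \<le> k" "good (Suc k)"
  shows "appr \<zeta> C (r (Suc k) + t k) (r (Suc k) + q k)"
proof (cases "good k")
  case True
  then show ?thesis using assms unfolding scheme_def by simp
next
  case False
  obtain j where j: "k = Suc j" "5 \<le> j" using assms(2) by (cases k) auto
  have "sharp \<zeta> C (q j) (r j + q (Suc j))" using assms(1) j False unfolding scheme_def by simp
  then have "appr \<zeta> C (q j) (r j + q (Suc j))" unfolding sharp_def appr_def by (rule sharply_imp_approximable)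
  then show ?thesis using False r_skip[of j] t_skip[of j] r_t[of j] unfolding j(1) by simp
qed

text \<open>Take \<open>q k \<le> N < q (Suc k)\<close>. If \<open>k\<close> and
  \<open>Suc k\<close> are good, the numbers \<open>r (Suc k)\<close>,
  \<open>r (Suc k) + t k\<close> and \<open>r (Suc k) + q k\<close> divide this range among the four
  families; for \<open>b (Suc k) = 0\<close> the second of them is already \<open>q (Suc k)\<close>.
  If \<open>Suc k\<close> is not good, a single interval covers the range. If \<open>k\<close> is
  not good, the interval of the preceding index still reaches up to
  \<open>r (Suc k) + q k\<close>.\<close>

lemma scheme_cover:
  assumes S: "scheme \<zeta> C" and K: "6 \<le> K"
    and N1: "\<And>k. K \<le> k \<Longrightarrow> good k \<Longrightarrow> good (Suc k) \<Longrightarrow> real (r (Suc k) + t k) \<le> M * real (r (Suc k))"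
    and N2: "\<And>k. K \<le> k \<Longrightarrow> good (Suc k) \<Longrightarrow> real (r (Suc k) + q k) \<le> M * real (r (Suc k) + t k)"
    and N3: "\<And>k. K \<le> k \<Longrightarrow> real (q (Suc k)) \<le> M * real (r (Suc k) + q k)"
    and N4: "\<And>k. K \<le> k \<Longrightarrow> real (r (Suc (Suc k))) \<le> M * real (q (Suc k))"
    and N: "real (q (Suc K)) \<le> N"
  shows "\<exists>d n. sharp \<zeta> C d n \<and> real d \<le> N \<and> N \<le> real n \<and> real n \<le> M * real d"
proof -
  have ex: "\<exists>k. N < q k"
  proof -
    have "N < real (nat \<lceil>N\<rceil> + 1)" by linarith
    then show ?thesis using q_ge[of "nat \<lceil>N\<rceil> + 1"] by (intro exI[of _ "nat \<lceil>N\<rceil> + 1"]) linarith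
  qed
  define l where "l = (LEAST k. N < q k)"
  have l: "N < q l" unfolding l_def using LeastI_ex[OF ex] .
  have "Suc K < l" using l N q_mono[of l "Suc K"] by (meson linorder_not_le of_nat_le_iff order_less_le_trans order_less_irrefl)
  then obtain k where k: "l = Suc k" "K < k" by (cases l) auto
  have kN: "q k \<le> N" using not_less_Least[of k "\<lambda>k. N < q k"] k unfolding l_def by auto
  have Nk: "N < q (Suc k)" using l k by simp
  have k5: "5 \<le> k" "6 \<le> k" using K k by auto
  have nf: "\<exists>d n. sharp \<zeta> C d n \<and> real d \<le> N \<and> N \<le> real n \<and> real n \<le> M * real d"
    if "good (Suc k)" "r (Suc k) + q k \<le> N"
  proof (cases "full (Suc k)")
    case True
    then show ?thesis using S k5 that Nk N3[of k] k(2) unfolding scheme_def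
      by (intro exI[of _ "r (Suc k) + q k"] exI[of _ "q (Suc k)"]) auto
  next
    \<comment> \<open>The next index takes over: its interval starts at the same point
      \<open>r (Suc k) + q k\<close> and ends at \<open>q k + q (Suc k)\<close>, beyond
      \<open>N\<close>.\<close>
    case False
    then have f: "good (Suc (Suc k))" "rep (Suc k) = 0" by (auto simp: full_def)
    have rr: "r (Suc (Suc k)) = r (Suc k) + q k" using r_rec[of "Suc k"] f that by simp
    have e: "r (Suc (Suc k)) + t (Suc k) = q k + q (Suc k)" using rr r_t[of "Suc k"] by simp
    have "sharp \<zeta> C (r (Suc (Suc k))) (r (Suc (Suc k)) + t (Suc k))"
      using S k5 that(1) f unfolding scheme_def by simp
    moreover have "N \<le> real (r (Suc (Suc k)) + t (Suc k))" unfolding e using Nk by simp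
    moreover have "real (r (Suc (Suc k)) + t (Suc k)) \<le> M * r (Suc (Suc k))" using N1[of "Suc k"] k(2) that(1) f by simp
    moreover have "real (r (Suc (Suc k))) \<le> N" unfolding rr using that(2) by simp
    ultimately show ?thesis by blast
  qed
  consider (gg) "good k" "good (Suc k)" | (gb) "\<not> good (Suc k)" | (bg) "\<not> good k" "good (Suc k)" by blast
  then show ?thesis
  proof cases
    case gg
    consider "N \<le> r (Suc k)" | "r (Suc k) \<le> N" "N \<le> r (Suc k) + t k"
      | "r (Suc k) + t k < N" "N \<le> r (Suc k) + q k" | "r (Suc k) + q k \<le> N" by linarith
    then show ?thesis
    proof cases
      case 1
      obtain j where j: "k = Suc j" "K \<le> j" using k(2) by (cases k) auto
      have "real (r (Suc k)) \<le> M * q k" using N4[OF j(2)] j(1) by simp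
      moreover have "sharp \<zeta> C (q k) (r (Suc k))" using S k5 gg unfolding scheme_def by simp
      ultimately show ?thesis using 1 kN by blast
    next
      case 2
      have "sharp \<zeta> C (r (Suc k)) (r (Suc k) + t k)" using S k5 gg unfolding scheme_def by simp
      then show ?thesis using 2 N1[of k] gg k(2) by (intro exI conjI) auto
    next
      case 3
      have "0 < b (Suc k)"
      proof (rule ccontr)
        assume "\<not> 0 < b (Suc k)"
        then have "r (Suc k) + t k = q (Suc k)" using t_rec[of k] r_t[of "Suc k"] by simp
        then show False using 3(1) Nk by (simp flip: of_nat_add)
      qed
      then have "sharp \<zeta> C (r (Suc k) + t k) (r (Suc k) + q k)" using S k5 gg unfolding scheme_def by simp
      then show ?thesis using 3 N2[of k] gg k(2) by (intro exI conjI) auto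
    next
      case 4
      then show ?thesis using nf gg by simp
    qed
  next
    case gb
    have "sharp \<zeta> C (q k) (r k + q (Suc k))" using S k5 gb unfolding scheme_def by simp
    \<comment> \<open>The skip turns hypothesis \<open>N2\<close> at \<open>Suc k\<close> into this
      bound, since there \<open>r (Suc (Suc k)) + t (Suc k)\<close> is \<open>q k\<close>.\<close>
    moreover have "real (r k + q (Suc k)) \<le> M * q k"
      using N2[of "Suc k"] not_goodD(4)[OF gb] k(2) r_skip[OF gb] t_skip[OF gb] r_t[of k] by simp
    moreover have "N \<le> real (r k + q (Suc k))" using Nk by simp
    ultimately show ?thesis using kN by blast
  next
    case bg
    obtain j where j: "k = Suc j" "K \<le> j" using k(2) by (cases k) auto
    have nb: "\<not> good (Suc j)" using bg j by simp
    show ?thesis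
    proof (cases "N \<le> real (r j + q k)")
      case True
      have "sharp \<zeta> C (q j) (r j + q (Suc j))" using S j K nb unfolding scheme_def by simp
      moreover have "real (r j + q (Suc j)) \<le> M * q j"
        using N2[of "Suc j"] bg j r_skip[OF nb] t_skip[OF nb] r_t[of j] by simp
      moreover have "real (q j) \<le> N" using kN q_mono[of j k] j by simp
      ultimately show ?thesis using True j(1) by blast
    next
      case False
      then show ?thesis using nf bg r_skip[OF nb] j(1) by simp
    qed
  qed
qed

section \<open>Upper limits and the two inequalities for the exponent\<close>

lemma eventually_limsup_on:
  assumes "limsup_on S f < ereal w"
  obtains K where "\<And>k. K \<le> k \<Longrightarrow> k \<in> S \<Longrightarrow> f k < w"
  using Limsup_lessD[OF assms[unfolded limsup_on_def]]
  by (auto simp: eventually_inf_principal eventually_sequentially)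

lemma frequently_limsup_on:
  assumes "ereal w < limsup_on S f"
  shows "\<exists>k\<ge>K. k \<in> S \<and> w < f k"
proof (rule ccontr)
  assume "\<not> ?thesis"
  then have "eventually (\<lambda>k. ereal (f k) \<le> ereal w) (inf sequentially (principal S))"
    by (auto simp: eventually_inf_principal eventually_sequentially not_less)
  then have "limsup_on S f \<le> ereal w" unfolding limsup_on_def by (rule Limsup_bounded)
  then show False using assms by simp
qed

text \<open>Only values \<open>w\<close> above a known lower bound \<open>v\<close> of
  \<open>\<mu>\<close> need attention. With \<open>v = 2\<close> the strict inequality later
  excludes non-good indices.\<close>

lemma limsup_on_le:
  assumes "ereal v \<le> \<mu>" "\<And>w. v < w \<Longrightarrow> (\<And>K. \<exists>k\<ge>K. k \<in> S \<and> w < f k) \<Longrightarrow> ereal w \<le> \<mu>"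
  shows "limsup_on S f \<le> \<mu>"
proof (rule dense_le)
  fix x :: ereal assume x: "x < limsup_on S f"
  show "x \<le> \<mu>"
  proof (cases x)
    case (real w)
    show ?thesis
    proof (cases "v < w")
      case True
      then show ?thesis using assms(2)[of w] frequently_limsup_on x real by blast
    next
      case False
      then have "x \<le> ereal v" using real by simp
      then show ?thesis using assms(1) by (rule order_trans)
    qed
  qed (use x in auto)
qed

lemma good_iff: "int (a (k + 1)) - int (b (k + 1)) \<ge> 1 \<longleftrightarrow> good k"
  by (auto simp: good_def)

lemma nu_eqs:
  "nu1 a b = limsup_on {k. good k \<and> good (Suc k)} (\<lambda>k. 2 + real (t k) / real (r (Suc k)))"
  "nu2 a b = limsup_on {k. good (Suc k)} (\<lambda>k. 2 + real (r k) / (real (r (Suc k)) + real (t k)))"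
  "nu3 a b = limsup_on UNIV (\<lambda>k. 1 + real (q (Suc k)) / (real (r (Suc k)) + real (q k)))"
  "nu4 a b = limsup_on UNIV (\<lambda>k. 1 + real (r (Suc (Suc k))) / real (q (Suc k)))"
  using good_iff[of "Suc _"] good_iff
  by (simp_all add: nu1_def nu2_def nu3_def nu4_def ost_t_eq ost_r_eq)

lemma r_pos: "0 < r k"
  by (induction k rule: Ww.induct) (auto simp: Ww.simps)

text \<open>Every term is at least 2, and infinitely many good indices keep the upper limit from
  being taken over a finite set.\<close>

lemma nu2_ge_2: "2 \<le> nu2 a b"
proof (rule ccontr)
  assume "\<not> ?thesis"
  then have "nu2 a b < ereal 2" by simp
  then obtain K where K: "\<And>k. K \<le> k \<Longrightarrow> good (Suc k) \<Longrightarrow> 2 + real (r k) / (real (r (Suc k)) + real (t k)) < 2"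
    unfolding nu_eqs by (rule eventually_limsup_on) auto
  obtain k where "Suc K \<le> k" "good k" using good_frequently by blast
  then obtain j where "K \<le> j" "good (Suc j)" by (cases k) auto
  moreover have "0 \<le> real (r j) / (real (r (Suc j)) + real (t j))" by simp
  ultimately show False using K[of j] by linarith
qed

definition nu :: ereal where "nu = Max {nu1 a b, nu2 a b, nu3 a b, nu4 a b}"

lemma nu_ge: "nu1 a b \<le> nu" "nu2 a b \<le> nu" "nu3 a b \<le> nu" "nu4 a b \<le> nu"
  unfolding nu_def by (rule Max_ge; simp)+

lemma scheme_le_nu:
  assumes "scheme \<zeta> C" "1 \<le> C"
  shows "irrationality_exponent \<zeta> \<le> nu"
proof (rule dense_ge)
  fix x assume x: "nu < x"
  show "irrationality_exponent \<zeta> \<le> x"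
  proof (cases x)
    case (real w)
    have "2 \<le> nu" using nu2_ge_2 nu_ge(2) by (rule order_trans)
    from this x[unfolded real] have "2 < ereal w" by (rule order.strict_trans1)
    then have w: "2 < w" by simp
    have lt: "nu1 a b < ereal w" "nu2 a b < ereal w" "nu3 a b < ereal w" "nu4 a b < ereal w"
      using nu_ge x real by (auto simp: order.strict_trans1)
    obtain K1 where K1: "\<And>k. K1 \<le> k \<Longrightarrow> good k \<Longrightarrow> good (Suc k) \<Longrightarrow> 2 + real (t k) / real (r (Suc k)) < w"
      using lt(1) unfolding nu_eqs by (rule eventually_limsup_on) auto
    obtain K2 where K2: "\<And>k. K2 \<le> k \<Longrightarrow> good (Suc k) \<Longrightarrow> 2 + real (r k) / (real (r (Suc k)) + real (t k)) < w"
      using lt(2) unfolding nu_eqs by (rule eventually_limsup_on) auto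
    obtain K3 where K3: "\<And>k. K3 \<le> k \<Longrightarrow> 1 + real (q (Suc k)) / (real (r (Suc k)) + real (q k)) < w"
      using lt(3) unfolding nu_eqs by (rule eventually_limsup_on) auto
    obtain K4 where K4: "\<And>k. K4 \<le> k \<Longrightarrow> 1 + real (r (Suc (Suc k))) / real (q (Suc k)) < w"
      using lt(4) unfolding nu_eqs by (rule eventually_limsup_on) auto
    define K where "K = Max {6, K1, K2, K3, K4}"
    have K: "6 \<le> K" "K1 \<le> K" "K2 \<le> K" "K3 \<le> K" "K4 \<le> K" unfolding K_def by auto
    have le: "y \<le> (w - 1) * z" if "y / z < w - 1" "0 < z" for y z :: real
      using that by (simp add: divide_less_eq less_imp_le)
    have rp: "0 < real (r k)" for k using r_pos by simp
    have qp: "0 < real (q k)" for k by simp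
    have rt: "real (q k) = real (r k) + real (t k)" for k using r_t[of k] by (simp flip: of_nat_add)
    have "\<exists>d n. sharp \<zeta> C d n \<and> real d \<le> N \<and> N \<le> real n \<and> real n \<le> (w - 1) * real d"
      if "real (q (Suc K)) \<le> N" for N
    proof (rule scheme_cover[OF assms(1) K(1) _ _ _ _ that])
      fix k assume k: "K \<le> k"
      { assume g: "good k" "good (Suc k)"
        have "(real (r (Suc k)) + real (t k)) / real (r (Suc k)) < w - 1"
          using K1[of k] g k K rp[of "Suc k"] by (simp add: add_divide_distrib)
        then show "real (r (Suc k) + t k) \<le> (w - 1) * real (r (Suc k))" using le rp by simp }
      { assume g: "good (Suc k)"
        have p: "0 < real (r (Suc k)) + real (t k)" using rp[of "Suc k"] by linarith
        have "(real (r (Suc k)) + real (q k)) / (real (r (Suc k)) + real (t k))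
            = 1 + real (r k) / (real (r (Suc k)) + real (t k))" unfolding rt using p by (simp add: field_simps)
        then have "(real (r (Suc k)) + real (q k)) / (real (r (Suc k)) + real (t k)) < w - 1"
          using K2[of k] g k K by simp
        then show "real (r (Suc k) + q k) \<le> (w - 1) * real (r (Suc k) + t k)" using le p by simp }
      have "0 < real (r (Suc k)) + real (q k)" using rp[of "Suc k"] by linarith
      then show "real (q (Suc k)) \<le> (w - 1) * real (r (Suc k) + q k)"
        using le[of "real (q (Suc k))" "real (r (Suc k)) + real (q k)"] K3[of k] k K by simp
      show "real (r (Suc (Suc k))) \<le> (w - 1) * real (q (Suc k))"
        using le[of "real (r (Suc (Suc k)))" "real (q (Suc k))"] K4[of k] k K qp[of "Suc k"] by simp
    qed
    then have "irrationality_exponent \<zeta> \<le> ereal w"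
      unfolding sharp_def using base_gt_1 assms(2) w by (intro irrationality_exponent_le) auto
    then show ?thesis using real by simp
  qed (use x in auto)
qed

lemma scheme_irrational:
  assumes "scheme \<zeta> C" "1 \<le> C"
  shows "\<zeta> \<notin> \<rat>"
proof (rule irrational_if_sharply_approximable[of C])
  fix K :: real
  obtain m where m: "K < base ^ m" using real_arch_pow[OF base_gt_1] by blast
  have big: "K \<le> base ^ n" if "m \<le> n" for n
    using m power_increasing[OF that, of base] base_gt_1 by (meson less_imp_le order_trans)
  obtain k where k: "m + 6 \<le> k" "good k" using good_frequently by blast
  show "\<exists>u v. K \<le> v \<and> sharply_approximable \<zeta> C u v"
  proof (cases "good (Suc k)")
    case True
    then have "sharp \<zeta> C (q k) (r (Suc k))" using assms(1) k unfolding scheme_def by simp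
    moreover have "m \<le> r (Suc k)" using r_rec[of k] k q_ge[of "k - 1"] by simp
    ultimately show ?thesis using big unfolding sharp_def by blast
  next
    case False
    then have "sharp \<zeta> C (q k) (r k + q (Suc k))" using assms(1) k unfolding scheme_def by simp
    moreover have "m \<le> r k + q (Suc k)" using q_ge[of "Suc k"] k by simp
    ultimately show ?thesis using big unfolding sharp_def by blast
  qed
qed (use assms in simp)

lemma nu_le_scheme:
  assumes S: "scheme \<zeta> C" "1 \<le> C"
  shows "nu \<le> irrationality_exponent \<zeta>"
proof -
  let ?\<mu> = "irrationality_exponent \<zeta>"
  have ge: "ereal w \<le> ?\<mu>" if "1 < w" "\<And>K. \<exists>d n. K \<le> d \<and> appr \<zeta> C d n \<and> (w - 1) * real d \<le> real n" for w
    using irrationality_exponent_ge[OF scheme_irrational[OF S] base_gt_1 S(2) that(1)] that(2) unfolding appr_def by blast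
  have rt: "real (q k) = real (r k) + real (t k)" for k using r_t[of k] by (simp flip: of_nat_add)
  have rp: "0 < real (r k)" for k using r_pos by simp
  have r_large: "k \<le> r (Suc (Suc k))" if "good (Suc k)" for k
    using r_rec[of "Suc k"] that q_ge[of k] by simp
  \<comment> \<open>The exponents of the denominators must be unbounded, but \<open>r\<close> alone
    can stay bounded along skipped indices; there the sum equals \<open>q k\<close>.\<close>
  have rt_large: "k \<le> r (Suc (Suc k)) + t (Suc k)" for k
  proof (cases "good (Suc k)")
    case False
    then show ?thesis using r_skip t_skip r_t[of k] q_ge[of k] by simp
  qed (use r_large[of k] in simp)
  have two: "ereal 2 \<le> ?\<mu>"
  proof (rule ge)
    fix K
    obtain k where k: "K + 8 \<le> k" "good k" using good_frequently by blast
    define j where "j = k - 2"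
    have kj: "k = Suc (Suc j)" using k by (simp add: j_def)
    have "appr \<zeta> C (r k + t (Suc j)) (r k + q (Suc j))" using appr_r_t[OF S(1), of "Suc j"] k kj by simp
    moreover have "K \<le> r k + t (Suc j)" using rt_large[of j] k kj by simp
    moreover have "(2 - 1) * real (r k + t (Suc j)) \<le> real (r k + q (Suc j))" using rt[of "Suc j"] by simp
    ultimately show "\<exists>d n. K \<le> d \<and> appr \<zeta> C d n \<and> (2 - 1) * real d \<le> real n" by blast
  qed simp
  have 1: "nu1 a b \<le> ?\<mu>" unfolding nu_eqs
  proof (rule limsup_on_le[OF two], rule ge)
    fix w :: real and K assume w: "2 < w"
      and fr: "\<And>K. \<exists>k\<ge>K. k \<in> {k. good k \<and> good (Suc k)} \<and> w < 2 + real (t k) / real (r (Suc k))"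
    obtain k where k: "K + 8 \<le> k" "good k" "good (Suc k)" "w < 2 + real (t k) / real (r (Suc k))" using fr by blast
    have "sharp \<zeta> C (r (Suc k)) (r (Suc k) + t k)" using S k unfolding scheme_def by simp
    then have "appr \<zeta> C (r (Suc k)) (r (Suc k) + t k)" unfolding sharp_def appr_def by (rule sharply_imp_approximable)
    moreover have "K \<le> r (Suc k)" using r_large[of "k - 1"] k by simp
    moreover have "(w - 1) * real (r (Suc k)) \<le> real (r (Suc k) + t k)"
    proof -
      have "(w - 2) * real (r (Suc k)) < real (t k)" using k(4) rp[of "Suc k"] by (simp flip: pos_less_divide_eq)
      then show ?thesis by (simp add: algebra_simps)
    qed
    ultimately show "\<exists>d n. K \<le> d \<and> appr \<zeta> C d n \<and> (w - 1) * real d \<le> real n" by blast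
  qed simp
  have 2: "nu2 a b \<le> ?\<mu>" unfolding nu_eqs
  proof (rule limsup_on_le[OF two], rule ge)
    fix w :: real and K assume w: "2 < w"
      and fr: "\<And>K. \<exists>k\<ge>K. k \<in> {k. good (Suc k)} \<and> w < 2 + real (r k) / (real (r (Suc k)) + real (t k))"
    obtain k where k: "K + 8 \<le> k" "good (Suc k)" "w < 2 + real (r k) / (real (r (Suc k)) + real (t k))" using fr by blast
    have "appr \<zeta> C (r (Suc k) + t k) (r (Suc k) + q k)" using appr_r_t[OF S(1)] k by simp
    moreover have "K \<le> r (Suc k) + t k" using rt_large[of "k - 1"] k by simp
    moreover have "(w - 1) * real (r (Suc k) + t k) \<le> real (r (Suc k) + q k)"
    proof -
      have "(w - 2) * (real (r (Suc k)) + real (t k)) < real (r k)" using k(3) rp[of "Suc k"]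
        by (simp add: add_pos_nonneg flip: pos_less_divide_eq)
      then show ?thesis using rt[of k] by (simp add: algebra_simps)
    qed
    ultimately show "\<exists>d n. K \<le> d \<and> appr \<zeta> C d n \<and> (w - 1) * real d \<le> real n" by blast
  qed simp
  have 3: "nu3 a b \<le> ?\<mu>" unfolding nu_eqs
  proof (rule limsup_on_le[OF two], rule ge)
    fix w :: real and K assume w: "2 < w"
      and fr: "\<And>K. \<exists>k\<ge>K. k \<in> UNIV \<and> w < 1 + real (q (Suc k)) / (real (r (Suc k)) + real (q k))"
    obtain k where k: "K + 8 \<le> k" "w < 1 + real (q (Suc k)) / (real (r (Suc k)) + real (q k))" using fr by blast
    have le: "(w - 1) * real (r (Suc k) + q k) \<le> real (q (Suc k))"
    proof -
      have "0 < real (r (Suc k)) + real (q k)" using rp[of "Suc k"] by linarith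
      moreover have "w - 1 < real (q (Suc k)) / (real (r (Suc k)) + real (q k))" using k(2) by linarith
      ultimately show ?thesis by (simp add: pos_less_divide_eq less_imp_le)
    qed
    \<comment> \<open>At a non-good index \<open>q (Suc k) \<le> r (Suc k) + q k\<close>, so the
      term is at most 2, against \<open>w > 2\<close>.\<close>
    have "good (Suc k)"
    proof (rule ccontr)
      assume "\<not> good (Suc k)"
      then have "q (Suc k) \<le> r (Suc k) + q k" using t_skip r_t[of "Suc k"] r_t[of k] by simp
      then have "real (q (Suc k)) \<le> 1 * real (r (Suc k) + q k)" by (simp flip: of_nat_add)
      also have "\<dots> < (w - 1) * real (r (Suc k) + q k)"
      proof (rule mult_strict_right_mono)
        show "0 < real (r (Suc k) + q k)" using rp[of "Suc k"] unfolding of_nat_add by linarith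
      qed (use w in simp)
      finally show False using le by simp
    qed
    then have "appr \<zeta> C (r (Suc k) + q k) (q (Suc k))" using S k unfolding scheme_def by simp
    moreover have "K \<le> r (Suc k) + q k" using q_ge[of k] k by simp
    ultimately show "\<exists>d n. K \<le> d \<and> appr \<zeta> C d n \<and> (w - 1) * real d \<le> real n" using le by blast
  qed simp
  have 4: "nu4 a b \<le> ?\<mu>" unfolding nu_eqs
  proof (rule limsup_on_le[OF two], rule ge)
    fix w :: real and K assume w: "2 < w"
      and fr: "\<And>K. \<exists>k\<ge>K. k \<in> UNIV \<and> w < 1 + real (r (Suc (Suc k))) / real (q (Suc k))"
    obtain k where k: "K + 8 \<le> k" "w < 1 + real (r (Suc (Suc k))) / real (q (Suc k))" using fr by blast
    have qp: "0 < real (q (Suc k))" using q_pos[of "Suc k"] by simp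
    have le: "(w - 1) * real (q (Suc k)) \<le> real (r (Suc (Suc k)))"
    proof -
      have "w - 1 < real (r (Suc (Suc k))) / real (q (Suc k))" using k(2) by linarith
      then show ?thesis using qp by (simp add: pos_less_divide_eq less_imp_le)
    qed
    have g: "good (Suc k)"
    proof (rule ccontr)
      assume "\<not> good (Suc k)"
      then have "r (Suc (Suc k)) \<le> q (Suc k)" using r_skip r_t[of k] q_mono[of k "Suc k"] by simp
      then have "real (r (Suc (Suc k))) \<le> 1 * real (q (Suc k))" by simp
      also have "\<dots> < (w - 1) * real (q (Suc k))"
        using w qp by (intro mult_strict_right_mono) auto
      finally show False using le by simp
    qed
    \<comment> \<open>If \<open>Suc (Suc k)\<close> is not good, the approximation is even better
      than needed, and a larger \<open>n\<close> appears.\<close>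
    have "\<exists>n\<ge>r (Suc (Suc k)). sharp \<zeta> C (q (Suc k)) n"
    proof (cases "good (Suc (Suc k))")
      case True
      then show ?thesis using S k g unfolding scheme_def by auto
    next
      case False
      then have "sharp \<zeta> C (q (Suc k)) (r (Suc k) + q (Suc (Suc k)))" using S k unfolding scheme_def by simp
      moreover have "r (Suc (Suc k)) \<le> r (Suc k) + q (Suc (Suc k))" using r_t[of "Suc (Suc k)"] by simp
      ultimately show ?thesis by blast
    qed
    then obtain n where n: "r (Suc (Suc k)) \<le> n" "sharp \<zeta> C (q (Suc k)) n" by blast
    have "appr \<zeta> C (q (Suc k)) n" using n(2) unfolding sharp_def appr_def by (rule sharply_imp_approximable)
    moreover have "K \<le> q (Suc k)" using q_ge[of "Suc k"] k by simp
    moreover have "(w - 1) * real (q (Suc k)) \<le> real n" using le n(1) by linarith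
    ultimately show "\<exists>d n. K \<le> d \<and> appr \<zeta> C d n \<and> (w - 1) * real d \<le> real n" by blast
  qed simp
  show ?thesis unfolding nu_def using 1 2 3 4 by simp
qed

section \<open>From the limit word to the floor and ceiling words\<close>

lemma irrationality_exponent_affine:
  fixes g h c :: int
  assumes "0 < g" "0 < h" "\<zeta> = (g * \<xi> + c) / h"
  shows "irrationality_exponent \<zeta> = nu"
proof -
  obtain C where "1 \<le> C" "scheme \<xi> C" using scheme_xi by blast
  then obtain C' where "1 \<le> C'" "scheme \<zeta> C'" using scheme_affine assms by blast
  then show ?thesis using scheme_le_nu nu_le_scheme by (intro antisym) auto
qed

text \<open>
  The constraint determines the partial sums of \<open>w\<close> except at the at most one index \<open>n\<close> with
  \<open>n * \<theta> + \<rho>\<close> an integer, which is where the floor and ceiling words differ.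
\<close>

lemma value_between:
  assumes w: "\<And>n. w (Suc n) \<le> 1"
    and sums: "\<And>n. real (\<Sum>h=1..n. w h) \<le> n * \<theta> + \<rho>" "\<And>n. n * \<theta> + \<rho> \<le> real (\<Sum>h=1..n. w h) + 1"
  obtains g c :: int where "0 < g" "value_of w = (g * \<xi> + c) / g"
proof -
  have uniq: "i = j" if "real i * \<theta> + \<rho> \<in> \<int>" "real j * \<theta> + \<rho> \<in> \<int>" for i j
  proof (rule ccontr)
    assume "i \<noteq> j"
    have "(real i * \<theta> + \<rho>) - (real j * \<theta> + \<rho>) \<in> \<int>" using that by (rule Ints_diff)
    then have "(real i - real j) * \<theta> \<in> \<rat>" using Ints_subset_Rats by (auto simp: algebra_simps)
    then have "(real i - real j) * \<theta> / (real i - real j) \<in> \<rat>" by (intro Rats_divide) auto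
    then show False using \<open>i \<noteq> j\<close> \<theta>_irrational by simp
  qed
  obtain m where m: "\<And>n. m \<le> n \<Longrightarrow> real n * \<theta> + \<rho> \<notin> \<int>"
  proof (cases "\<exists>i. real i * \<theta> + \<rho> \<in> \<int>")
    case True
    then obtain i where "real i * \<theta> + \<rho> \<in> \<int>" by blast
    then show thesis using uniq that[of "Suc i"] by (metis Suc_n_not_le_n)
  qed (use that in blast)
  have "(\<Sum>h=1..n. lw h) = (\<Sum>h=1..n. w h)" if "m \<le> n" for n
  proof -
    have f: "S = \<lfloor>real n * \<theta> + \<rho>\<rfloor>" if "real_of_int S \<le> n * \<theta> + \<rho>" "n * \<theta> + \<rho> \<le> real_of_int S + 1" for S
    proof -
      have "n * \<theta> + \<rho> \<noteq> real_of_int (S + 1)" using m[OF \<open>m \<le> n\<close>] by (metis Ints_of_int)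
      then show ?thesis using that by (intro floor_unique[symmetric]) auto
    qed
    have "int (\<Sum>h=1..n. lw h) = \<lfloor>real n * \<theta> + \<rho>\<rfloor>" using sum_lw_bounds[of n] by (intro f) auto
    moreover have "int (\<Sum>h=1..n. w h) = \<lfloor>real n * \<theta> + \<rho>\<rfloor>" using sums[of n] by (intro f) auto
    ultimately show ?thesis by linarith
  qed
  from value_eventually_equal_sums[OF lw_binary w this] that show thesis by blast
qed

lemma sturmian_floor_bounds:
  "sturmian_floor \<theta> \<rho> (Suc n) \<le> 1"
  "int (\<Sum>h=1..n. sturmian_floor \<theta> \<rho> h) = \<lfloor>real n * \<theta> + \<rho>\<rfloor>"
proof -
  have step: "int (sturmian_floor \<theta> \<rho> (Suc n)) = \<lfloor>real (Suc n) * \<theta> + \<rho>\<rfloor> - \<lfloor>real n * \<theta> + \<rho>\<rfloor>" for n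
  proof -
    have "\<lfloor>real n * \<theta> + \<rho>\<rfloor> \<le> \<lfloor>real (Suc n) * \<theta> + \<rho>\<rfloor>" using \<theta>_pos by (intro floor_mono) (simp add: algebra_simps)
    then show ?thesis by (simp add: sturmian_floor_def)
  qed
  have "\<lfloor>real (Suc n) * \<theta> + \<rho>\<rfloor> \<le> \<lfloor>real n * \<theta> + \<rho> + 1\<rfloor>" using \<theta>_less_1 by (intro floor_mono) (simp add: algebra_simps)
  then show "sturmian_floor \<theta> \<rho> (Suc n) \<le> 1" using step[of n] by simp
  show "int (\<Sum>h=1..n. sturmian_floor \<theta> \<rho> h) = \<lfloor>real n * \<theta> + \<rho>\<rfloor>"
  proof (induction n)
    case 0 then show ?case using \<rho>_nonneg \<rho>_less_1 by (simp add: floor_eq_iff)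
  next
    case (Suc n)
    have "(\<Sum>h=1..Suc n. sturmian_floor \<theta> \<rho> h) = (\<Sum>h=1..n. sturmian_floor \<theta> \<rho> h) + sturmian_floor \<theta> \<rho> (Suc n)" by simp
    then show ?case using Suc step[of n] by linarith
  qed
qed

lemma sturmian_ceiling_bounds:
  "sturmian_ceiling \<theta> \<rho> (Suc n) \<le> 1"
  "int (\<Sum>h=1..n. sturmian_ceiling \<theta> \<rho> h) = \<lceil>real n * \<theta> + \<rho>\<rceil> - \<lceil>\<rho>\<rceil>"
proof -
  have step: "int (sturmian_ceiling \<theta> \<rho> (Suc n)) = \<lceil>real (Suc n) * \<theta> + \<rho>\<rceil> - \<lceil>real n * \<theta> + \<rho>\<rceil>" for n
  proof -
    have "\<lceil>real n * \<theta> + \<rho>\<rceil> \<le> \<lceil>real (Suc n) * \<theta> + \<rho>\<rceil>" using \<theta>_pos by (intro ceiling_mono) (simp add: algebra_simps)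
    then show ?thesis by (simp add: sturmian_ceiling_def)
  qed
  have "\<lceil>real (Suc n) * \<theta> + \<rho>\<rceil> \<le> \<lceil>real n * \<theta> + \<rho> + 1\<rceil>" using \<theta>_less_1 by (intro ceiling_mono) (simp add: algebra_simps)
  then show "sturmian_ceiling \<theta> \<rho> (Suc n) \<le> 1" using step[of n] by simp
  show "int (\<Sum>h=1..n. sturmian_ceiling \<theta> \<rho> h) = \<lceil>real n * \<theta> + \<rho>\<rceil> - \<lceil>\<rho>\<rceil>"
  proof (induction n)
    case (Suc n)
    have "(\<Sum>h=1..Suc n. sturmian_ceiling \<theta> \<rho> h) = (\<Sum>h=1..n. sturmian_ceiling \<theta> \<rho> h) + sturmian_ceiling \<theta> \<rho> (Suc n)" by simp
    then show ?case using Suc step[of n] by linarith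
  qed simp
qed

lemma irrationality_exponent_floor: "irrationality_exponent (value_of (sturmian_floor \<theta> \<rho>)) = nu"
proof -
  have "real (\<Sum>h=1..n. sturmian_floor \<theta> \<rho> h) = real_of_int \<lfloor>real n * \<theta> + \<rho>\<rfloor>" for n
    unfolding sturmian_floor_bounds(2)[symmetric] by simp
  then have "real (\<Sum>h=1..n. sturmian_floor \<theta> \<rho> h) \<le> n * \<theta> + \<rho>"
    "n * \<theta> + \<rho> \<le> real (\<Sum>h=1..n. sturmian_floor \<theta> \<rho> h) + 1" for n
    by (simp_all del: of_nat_sum)
  from value_between[OF sturmian_floor_bounds(1) this] obtain g c :: int
    where "0 < g" "value_of (sturmian_floor \<theta> \<rho>) = (g * \<xi> + c) / g" by blast
  then show ?thesis using irrationality_exponent_affine by blast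
qed

text \<open>For \<open>\<rho> = 0\<close> the partial sums exceed \<open>n * \<theta>\<close>,
  because \<open>\<lceil>\<rho>\<rceil>\<close> is 0 instead of 1. Replacing the first letter 1 by 0
  restores the required bounds. It also changes the weight of that letter from \<open>B * A\<close>
  to \<open>B\<close>, so the affine relation has different multipliers in numerator and
  denominator.\<close>

lemma irrationality_exponent_ceiling: "irrationality_exponent (value_of (sturmian_ceiling \<theta> \<rho>)) = nu"
proof (cases "\<rho> = 0")
  case False
  then have c1: "\<lceil>\<rho>\<rceil> = 1" using \<rho>_nonneg \<rho>_less_1 by (simp add: ceiling_eq_iff)
  have "real (\<Sum>h=1..n. sturmian_ceiling \<theta> \<rho> h) = real_of_int (\<lceil>real n * \<theta> + \<rho>\<rceil> - 1)" for n
    unfolding c1[symmetric] sturmian_ceiling_bounds(2)[symmetric] by simp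
  then have "real (\<Sum>h=1..n. sturmian_ceiling \<theta> \<rho> h) \<le> n * \<theta> + \<rho>"
    "n * \<theta> + \<rho> \<le> real (\<Sum>h=1..n. sturmian_ceiling \<theta> \<rho> h) + 1" for n
    by (simp_all del: of_nat_sum)
  from value_between[OF sturmian_ceiling_bounds(1) this] obtain g c :: int
    where "0 < g" "value_of (sturmian_ceiling \<theta> \<rho>) = (g * \<xi> + c) / g" by blast
  then show ?thesis using irrationality_exponent_affine by blast
next
  case True
  let ?s = "sturmian_ceiling \<theta> \<rho>"
  define w where "w = (\<lambda>n. if n = 1 then 0 else ?s n)"
  have w: "w (Suc n) \<le> 1" for n using sturmian_ceiling_bounds(1) by (simp add: w_def)
  have "\<lceil>\<theta>\<rceil> = 1" using \<theta>_pos \<theta>_less_1 by (simp add: ceiling_eq_iff)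
  then have s1: "?s 1 = 1" using sturmian_ceiling_bounds(2)[of 1] True by simp
  have sum_s: "(\<Sum>h=1..n. ?s h) = (\<Sum>h=1..n. w h) + 1" if "1 \<le> n" for n
    using that by (induction n rule: dec_induct) (auto simp: w_def s1[unfolded One_nat_def])
  have sums: "real (\<Sum>h=1..n. w h) \<le> n * \<theta> + \<rho> \<and> n * \<theta> + \<rho> \<le> real (\<Sum>h=1..n. w h) + 1" for n
  proof (cases "1 \<le> n")
    case n: True
    have "real (\<Sum>h=1..n. ?s h) = real_of_int \<lceil>real n * \<theta> + \<rho>\<rceil>"
      using arg_cong[OF sturmian_ceiling_bounds(2)[of n], of real_of_int] True by simp
    then have "real (\<Sum>h=1..n. w h) + 1 = real_of_int \<lceil>real n * \<theta> + \<rho>\<rceil>" unfolding sum_s[OF n] by simp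
    then show ?thesis by linarith
  next
    case False
    then have "n = 0" by simp
    then show ?thesis using True by simp
  qed
  obtain g c :: int where gc: "0 < g" "value_of w = (g * \<xi> + c) / g"
    using value_between[OF w conjunct1[OF sums] conjunct2[OF sums]] by blast
  have "value_of (\<lambda>n. ?s (Suc n)) = value_of (\<lambda>n. w (Suc n))"
  proof -
    have "(\<Sum>h=1..Suc n. ?s (Suc h)) = (\<Sum>h=1..Suc n. w (Suc h))" for n
      by (intro sum.cong) (auto simp: w_def)
    then show ?thesis unfolding xi_def by (simp add: w_def)
  qed
  then obtain \<tau> where t: "value_of ?s = act [1] \<tau>" "value_of w = act [0] \<tau>"
    using value_Cons[of ?s, OF sturmian_ceiling_bounds(1)] value_Cons[of w, OF w] s1 by (simp add: w_def)
  have BA: "real_of_int B \<noteq> 0" "real_of_int A \<noteq> 0" using A_ge_1 B_ge_2 by auto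
  have "\<tau> = B * value_of w" unfolding t(2) act_def using BA by simp
  then have "value_of ?s = (1 + B * value_of w) / (B * A)" unfolding t(1) act_def by simp
  also have "\<dots> = ((B * g) * \<xi> + (B * c + g)) / (g * (B * A))" unfolding gc(2) using gc(1) BA by (simp add: field_simps)
  finally have "value_of ?s = (real_of_int (B * g) * \<xi> + real_of_int (B * c + g)) / real_of_int (g * (B * A))" by simp
  then show ?thesis by (rule irrationality_exponent_affine[rotated 2]) (use gc(1) A B in simp_all)
qed

end

theorem theorem1p5:
  fixes \<theta> \<rho> :: real and a b :: "nat \<Rightarrow> nat" and A B :: int
  assumes "0 < \<theta>" and "\<theta> < 1" and "\<theta> \<notin> \<rat>"
    and "cf_expansion \<theta> a"
    and "0 \<le> \<rho>" and "\<rho> < 1"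
    and "ostrowski_digits \<theta> a (\<rho> - \<theta>) b"
    and "B \<ge> 2" and "A \<ge> 1"
  shows "irrationality_exponent (xi (sturmian_floor \<theta> \<rho>) (1 / real_of_int B) (1 / real_of_int A))
           = Max {nu1 a b, nu2 a b, nu3 a b, nu4 a b} \<and>
         irrationality_exponent (xi (sturmian_ceiling \<theta> \<rho>) (1 / real_of_int B) (1 / real_of_int A))
           = Max {nu1 a b, nu2 a b, nu3 a b, nu4 a b}"
proof -
  interpret sturmian_word B A \<theta> \<rho> a b
    by unfold_locales (use assms in auto)
  show ?thesis
    using irrationality_exponent_floor irrationality_exponent_ceiling unfolding nu_def by blast
qed

end
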